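(* If $\mathcal{Q}$ is a small Girard quantaloid, then a $\mathcal{Q}$-category is (ccd) if and only if it is $^{\mathrm{op}}$(ccd).
   Context: A quantaloid is a category whose hom-sets are complete lattices and whose composition preserves arbitrary joins in each variable; it is small if it has a set of objects. For arrows $f:X\to Y$, $g:Y\to Z$, $h:X\to Z$ the residuals $h\swarrow f:Y\to Z$ and $g\searrow h:X\to Y$ are determined by $g\circ f\le h\iff g\le h\swarrow f\iff f\le g\searrow h$. A Girard quantaloid is a quantaloid $\mathcal{Q}$ equipped with a family $\{d_X:X\to X\}_{X\in\mathrm{ob}\,\mathcal{Q}}$ that is cyclic ($d_X\swarrow f=f\searrow d_Y$ for all $f:X\to Y$) and dualizing ($(d_X\swarrow f)\searrow d_X=f=d_Y\swarrow(f\searrow d_Y)$ for all $f:X\to Y$). A (small) $\mathcal{Q}$-category $\mathbb{A}$ consists of a set $\mathbb{A}_0$ of objects, a type map $t:\mathbb{A}_0\to\mathrm{ob}\,\mathcal{Q}$ and hom-arrows $\mathbb{A}(x,y)\in\mathcal{Q}(tx,ty)$ with $1_{tx}\le\mathbb{A}(x,x)$ and $\mathbb{A}(y,z)\circ\mathbb{A}(x,y)\le\mathbb{A}(x,z)$. Its underlying order: $x\le y$ iff $tx=ty$ and $1_{tx}\le\mathbb{A}(x,y)$. A $\mathcal{Q}$-functor $F:\mathbb{A}\to\mathbb{B}$ is a type-preserving map on objects with $\mathbb{A}(x,y)\le\mathbb{B}(Fx,Fy)$; $\mathcal{Q}$-functors are ordered pointwise by the underlying order, giving a 2-category $\mathcal{Q}\text{-}\mathbf{Cat}$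 in which adjunctions are taken ($F\dashv G$ iff $1\le GF$ and $FG\le 1$). A $\mathcal{Q}$-distributor $\phi:\mathbb{A}\nrightarrow\mathbb{B}$ assigns to each $(x,y)\in\mathbb{A}_0\times\mathbb{B}_0$ an arrow $\phi(x,y)\in\mathcal{Q}(tx,ty)$ with $\mathbb{B}(y,y')\circ\phi(x,y)\circ\mathbb{A}(x',x)\le\phi(x',y')$. With composition $(\psi\circ\phi)(x,z)=\bigvee_{y}\psi(y,z)\circ\phi(x,y)$, identities given by the hom-arrows, and pointwise order, $\mathcal{Q}$-categories and $\mathcal{Q}$-distributors form a quantaloid (with residuals also denoted $\swarrow,\searrow$). For $X\in\mathrm{ob}\,\mathcal{Q}$ let $\star_X$ be the $\mathcal{Q}$-category with a single object of type $X$ and hom-arrow $1_X$. The presheaf $\mathcal{Q}$-category $\mathcal{P}\mathbb{A}$ has as objects of type $X$ the $\mathcal{Q}$-distributors $\mu:\mathbb{A}\nrightarrow\star_X$, with $\mathcal{P}\mathbb{A}(\mu,\mu')=\mu'\swarrow\mu$. The copresheaf $\mathcal{Q}$-category $\mathcal{P}^{\dagger}\mathbb{A}$ has as objects of type $X$ the $\mathcal{Q}$-distributors $\lambda:\star_X\nrightarrow\mathbb{A}$, with $\mathcal{P}^{\dagger}\mathbb{A}(\lambda,\lambda')=\lambda'\searrow\lambda$. $\mathbb{A}$ is complete if the Yoneda embedding $\mathbb{A}\to\mathcal{P}\mathbb{A}$, $x\mapsto\mathbb{A}(-,x)$, has a left adjoint $\sup_{\mathbb{A}}$ in $\mathcal{Q}\text{-}\mathbf{Cat}$;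 equivalently, the co-Yoneda embedding $\mathbb{A}\to\mathcal{P}^{\dagger}\mathbb{A}$, $x\mapsto\mathbb{A}(x,-)$, has a right adjoint $\inf_{\mathbb{A}}:\mathcal{P}^{\dagger}\mathbb{A}\to\mathbb{A}$. $\mathbb{A}$ is (ccd) if it is complete and $\sup_{\mathbb{A}}$ has a left adjoint in $\mathcal{Q}\text{-}\mathbf{Cat}$; it is $^{\mathrm{op}}$(ccd) if it is complete and $\inf_{\mathbb{A}}$ has a right adjoint in $\mathcal{Q}\text{-}\mathbf{Cat}$. *)

theory Defs
  imports "HOL-Algebra.Complete_Lattice" "HOL-Library.FuncSet"
begin

section \<open>Quantaloids\<close>

text \<open>
  Small categories are given by a set of objects and a set of arrows with source and target maps.
  The composite of \<open>f : X \<rightarrow> Y\<close> and \<open>g : Y \<rightarrow> Z\<close> is written \<open>g \<odot> f\<close>. A single relation \<open>\<preceq>\<close> carries the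
  orders of all hom-sets; it is only ever used between parallel arrows.
\<close>

record ('o, 'a) quantaloid_data =
  objs :: "'o set"
  arrs :: "'a set"
  src :: "'a \<Rightarrow> 'o"
  tgt :: "'a \<Rightarrow> 'o"
  qcomp :: "'a \<Rightarrow> 'a \<Rightarrow> 'a" (infixl \<open>\<odot>\<index>\<close> 70)
  qid :: "'o \<Rightarrow> 'a"
  qle :: "'a \<Rightarrow> 'a \<Rightarrow> bool" (infix \<open>\<preceq>\<index>\<close> 50)

definition Homs :: "('o, 'a) quantaloid_data \<Rightarrow> 'o \<Rightarrow> 'o \<Rightarrow> 'a set" where
  "Homs Q X Y = {f \<in> arrs Q. src Q f = X \<and> tgt Q f = Y}"

definition hom_order :: "('o, 'a) quantaloid_data \<Rightarrow> 'o \<Rightarrow> 'o \<Rightarrow> 'a gorder" where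
  "hom_order Q X Y = \<lparr>carrier = Homs Q X Y, eq = (=), le = qle Q\<rparr>"

locale quantaloid =
  fixes Q :: "('o, 'a) quantaloid_data" (structure)
  assumes src_objs: "f \<in> arrs Q \<Longrightarrow> src Q f \<in> objs Q"
    and tgt_objs: "f \<in> arrs Q \<Longrightarrow> tgt Q f \<in> objs Q"
    and comp_closed: "f \<in> Homs Q X Y \<Longrightarrow> g \<in> Homs Q Y Z \<Longrightarrow> g \<odot> f \<in> Homs Q X Z"
    and id_closed: "X \<in> objs Q \<Longrightarrow> qid Q X \<in> Homs Q X X"
    and comp_assoc: "f \<in> Homs Q W X \<Longrightarrow> g \<in> Homs Q X Y \<Longrightarrow> h \<in> Homs Q Y Z \<Longrightarrow>
      (h \<odot> g) \<odot> f = h \<odot> (g \<odot> f)"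
    and id_right: "f \<in> Homs Q X Y \<Longrightarrow> f \<odot> qid Q X = f"
    and id_left: "f \<in> Homs Q X Y \<Longrightarrow> qid Q Y \<odot> f = f"
    and hom_complete: "X \<in> objs Q \<Longrightarrow> Y \<in> objs Q \<Longrightarrow> complete_lattice (hom_order Q X Y)"
    and comp_Sup_right: "X \<in> objs Q \<Longrightarrow> g \<in> Homs Q Y Z \<Longrightarrow> F \<subseteq> Homs Q X Y \<Longrightarrow>
      g \<odot> (\<Squnion>\<^bsub>hom_order Q X Y\<^esub> F) = \<Squnion>\<^bsub>hom_order Q X Z\<^esub> ((\<lambda>f. g \<odot> f) ` F)"
    and comp_Sup_left: "Z \<in> objs Q \<Longrightarrow> f \<in> Homs Q X Y \<Longrightarrow> G \<subseteq> Homs Q Y Z \<Longrightarrow>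
      (\<Squnion>\<^bsub>hom_order Q Y Z\<^esub> G) \<odot> f = \<Squnion>\<^bsub>hom_order Q X Z\<^esub> ((\<lambda>g. g \<odot> f) ` G)"

text \<open>
  For \<open>f : X \<rightarrow> Y\<close>, \<open>g : Y \<rightarrow> Z\<close> and \<open>h : X \<rightarrow> Z\<close>: \<open>lres Q h f\<close> is \<open>h \<swarrow> f : Y \<rightarrow> Z\<close> and \<open>rres Q g h\<close> is
  \<open>g \<searrow> h : X \<rightarrow> Y\<close>. Both are meaningful only when \<open>h\<close> is parallel to the relevant composites.
\<close>

definition lres :: "('o, 'a) quantaloid_data \<Rightarrow> 'a \<Rightarrow> 'a \<Rightarrow> 'a" where
  "lres Q h f = (THE r. r \<in> Homs Q (tgt Q f) (tgt Q h) \<and>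
     (\<forall>g \<in> Homs Q (tgt Q f) (tgt Q h). g \<odot>\<^bsub>Q\<^esub> f \<preceq>\<^bsub>Q\<^esub> h \<longleftrightarrow> g \<preceq>\<^bsub>Q\<^esub> r))"

definition rres :: "('o, 'a) quantaloid_data \<Rightarrow> 'a \<Rightarrow> 'a \<Rightarrow> 'a" where
  "rres Q g h = (THE r. r \<in> Homs Q (src Q h) (src Q g) \<and>
     (\<forall>f \<in> Homs Q (src Q h) (src Q g). g \<odot>\<^bsub>Q\<^esub> f \<preceq>\<^bsub>Q\<^esub> h \<longleftrightarrow> f \<preceq>\<^bsub>Q\<^esub> r))"

locale girard_quantaloid = quantaloid Q
  for Q :: "('o, 'a) quantaloid_data" (structure) +
  fixes d :: "'o \<Rightarrow> 'a"
  assumes d_closed: "X \<in> objs Q \<Longrightarrow> d X \<in> Homs Q X X"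
    and cyclic: "f \<in> Homs Q X Y \<Longrightarrow> lres Q (d X) f = rres Q f (d Y)"
    and dualizing_left: "f \<in> Homs Q X Y \<Longrightarrow> rres Q (lres Q (d X) f) (d X) = f"
    and dualizing_right: "f \<in> Homs Q X Y \<Longrightarrow> lres Q (d Y) (rres Q f (d Y)) = f"


section \<open>Categories and functors enriched in a quantaloid\<close>

record ('o, 'a, 'x) qcat_data =
  obj :: "'x set"
  otyp :: "'x \<Rightarrow> 'o"
  qhom :: "'x \<Rightarrow> 'x \<Rightarrow> 'a"

definition qcategory :: "('o, 'a) quantaloid_data \<Rightarrow> ('o, 'a, 'x) qcat_data \<Rightarrow> bool" where
  "qcategory Q A \<longleftrightarrow>
     (\<forall>x \<in> obj A. otyp A x \<in> objs Q) \<and>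
     (\<forall>x \<in> obj A. \<forall>y \<in> obj A. qhom A x y \<in> Homs Q (otyp A x) (otyp A y)) \<and>
     (\<forall>x \<in> obj A. qid Q (otyp A x) \<preceq>\<^bsub>Q\<^esub> qhom A x x) \<and>
     (\<forall>x \<in> obj A. \<forall>y \<in> obj A. \<forall>z \<in> obj A. qhom A y z \<odot>\<^bsub>Q\<^esub> qhom A x y \<preceq>\<^bsub>Q\<^esub> qhom A x z)"

definition underlying_le ::
  "('o, 'a) quantaloid_data \<Rightarrow> ('o, 'a, 'x) qcat_data \<Rightarrow> 'x \<Rightarrow> 'x \<Rightarrow> bool" where
  "underlying_le Q A x y \<longleftrightarrow> otyp A x = otyp A y \<and> qid Q (otyp A x) \<preceq>\<^bsub>Q\<^esub> qhom A x y"

definition qfunctor :: "('o, 'a) quantaloid_data \<Rightarrow> ('o, 'a, 'x) qcat_data \<Rightarrow>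
    ('o, 'a, 'y) qcat_data \<Rightarrow> ('x \<Rightarrow> 'y) \<Rightarrow> bool" where
  "qfunctor Q A B F \<longleftrightarrow>
     (\<forall>x \<in> obj A. F x \<in> obj B \<and> otyp B (F x) = otyp A x) \<and>
     (\<forall>x \<in> obj A. \<forall>x' \<in> obj A. qhom A x x' \<preceq>\<^bsub>Q\<^esub> qhom B (F x) (F x'))"

text \<open>\<open>qadjoint Q A B F G\<close>: \<open>F : A \<rightarrow> B\<close> is left adjoint to \<open>G : B \<rightarrow> A\<close>.\<close>

definition qadjoint :: "('o, 'a) quantaloid_data \<Rightarrow> ('o, 'a, 'x) qcat_data \<Rightarrow>
    ('o, 'a, 'y) qcat_data \<Rightarrow> ('x \<Rightarrow> 'y) \<Rightarrow> ('y \<Rightarrow> 'x) \<Rightarrow> bool" where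
  "qadjoint Q A B F G \<longleftrightarrow>
     qfunctor Q A B F \<and> qfunctor Q B A G \<and>
     (\<forall>x \<in> obj A. underlying_le Q A x (G (F x))) \<and>
     (\<forall>y \<in> obj B. underlying_le Q B (F (G y)) y)"


section \<open>Distributors\<close>

text \<open>
  Distributors are extensional functions on \<open>obj A \<times> obj B\<close>, so that equality of functions is
  equality of distributors.
\<close>

definition distributor :: "('o, 'a) quantaloid_data \<Rightarrow> ('o, 'a, 'x) qcat_data \<Rightarrow>
    ('o, 'a, 'y) qcat_data \<Rightarrow> ('x \<times> 'y \<Rightarrow> 'a) \<Rightarrow> bool" where
  "distributor Q A B \<phi> \<longleftrightarrow>
     \<phi> \<in> (\<Pi>\<^sub>E (x, y) \<in> obj A \<times> obj B. Homs Q (otyp A x) (otyp B y)) \<and>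
     (\<forall>x \<in> obj A. \<forall>x' \<in> obj A. \<forall>y \<in> obj B. \<forall>y' \<in> obj B.
        qhom B y y' \<odot>\<^bsub>Q\<^esub> \<phi> (x, y) \<odot>\<^bsub>Q\<^esub> qhom A x' x \<preceq>\<^bsub>Q\<^esub> \<phi> (x', y'))"

definition dist_comp :: "('o, 'a) quantaloid_data \<Rightarrow> ('o, 'a, 'x) qcat_data \<Rightarrow>
    ('o, 'a, 'y) qcat_data \<Rightarrow> ('o, 'a, 'z) qcat_data \<Rightarrow>
    ('y \<times> 'z \<Rightarrow> 'a) \<Rightarrow> ('x \<times> 'y \<Rightarrow> 'a) \<Rightarrow> ('x \<times> 'z \<Rightarrow> 'a)" where
  "dist_comp Q A B C \<psi> \<phi> = (\<lambda>(x, z) \<in> obj A \<times> obj C.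
     \<Squnion>\<^bsub>hom_order Q (otyp A x) (otyp C z)\<^esub> ((\<lambda>y. \<psi> (y, z) \<odot>\<^bsub>Q\<^esub> \<phi> (x, y)) ` obj B))"

definition dist_le :: "('o, 'a) quantaloid_data \<Rightarrow> ('o, 'a, 'x) qcat_data \<Rightarrow>
    ('o, 'a, 'y) qcat_data \<Rightarrow> ('x \<times> 'y \<Rightarrow> 'a) \<Rightarrow> ('x \<times> 'y \<Rightarrow> 'a) \<Rightarrow> bool" where
  "dist_le Q A B \<phi> \<psi> \<longleftrightarrow> (\<forall>x \<in> obj A. \<forall>y \<in> obj B. \<phi> (x, y) \<preceq>\<^bsub>Q\<^esub> \<psi> (x, y))"

text \<open>
  The residuals \<open>\<chi> \<swarrow> \<phi>\<close> and \<open>\<psi> \<searrow> \<chi>\<close> in the quantaloid of distributors, for \<open>\<phi>\<close> from \<open>A\<close> to \<open>B\<close>,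
  \<open>\<psi>\<close> from \<open>B\<close> to \<open>C\<close> and \<open>\<chi>\<close> from \<open>A\<close> to \<open>C\<close>.
\<close>

definition dist_lres :: "('o, 'a) quantaloid_data \<Rightarrow> ('o, 'a, 'x) qcat_data \<Rightarrow>
    ('o, 'a, 'y) qcat_data \<Rightarrow> ('o, 'a, 'z) qcat_data \<Rightarrow>
    ('x \<times> 'z \<Rightarrow> 'a) \<Rightarrow> ('x \<times> 'y \<Rightarrow> 'a) \<Rightarrow> ('y \<times> 'z \<Rightarrow> 'a)" where
  "dist_lres Q A B C \<chi> \<phi> = (THE \<rho>. distributor Q B C \<rho> \<and>
     (\<forall>\<psi>. distributor Q B C \<psi> \<longrightarrow>
        (dist_le Q A C (dist_comp Q A B C \<psi> \<phi>) \<chi> \<longleftrightarrow> dist_le Q B C \<psi> \<rho>)))"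

definition dist_rres :: "('o, 'a) quantaloid_data \<Rightarrow> ('o, 'a, 'x) qcat_data \<Rightarrow>
    ('o, 'a, 'y) qcat_data \<Rightarrow> ('o, 'a, 'z) qcat_data \<Rightarrow>
    ('y \<times> 'z \<Rightarrow> 'a) \<Rightarrow> ('x \<times> 'z \<Rightarrow> 'a) \<Rightarrow> ('x \<times> 'y \<Rightarrow> 'a)" where
  "dist_rres Q A B C \<psi> \<chi> = (THE \<rho>. distributor Q A B \<rho> \<and>
     (\<forall>\<phi>. distributor Q A B \<phi> \<longrightarrow>
        (dist_le Q A C (dist_comp Q A B C \<psi> \<phi>) \<chi> \<longleftrightarrow> dist_le Q A B \<phi> \<rho>)))"


section \<open>Presheaves, completeness and complete distributivity\<close>

definition star :: "('o, 'a) quantaloid_data \<Rightarrow> 'o \<Rightarrow> ('o, 'a, unit) qcat_data" where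
  "star Q X = \<lparr>obj = {()}, otyp = (\<lambda>_. X), qhom = (\<lambda>_ _. qid Q X)\<rparr>"

text \<open>
  A (co)presheaf is paired with its type, which the underlying function does not determine when
  \<open>obj A\<close> is empty. A distributor from \<open>star Q X\<close> to \<open>star Q X'\<close> is identified with its single
  component, an arrow from \<open>X\<close> to \<open>X'\<close>.
\<close>

definition presheaves :: "('o, 'a) quantaloid_data \<Rightarrow> ('o, 'a, 'x) qcat_data \<Rightarrow>
    ('o, 'a, 'o \<times> ('x \<times> unit \<Rightarrow> 'a)) qcat_data" where
  "presheaves Q A = \<lparr>
     obj = {(X, \<mu>). X \<in> objs Q \<and> distributor Q A (star Q X) \<mu>},
     otyp = fst,
     qhom = (\<lambda>(X, \<mu>) (X', \<mu>'). dist_lres Q A (star Q X) (star Q X') \<mu>' \<mu> ((), ()))\<rparr>"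

definition copresheaves :: "('o, 'a) quantaloid_data \<Rightarrow> ('o, 'a, 'x) qcat_data \<Rightarrow>
    ('o, 'a, 'o \<times> (unit \<times> 'x \<Rightarrow> 'a)) qcat_data" where
  "copresheaves Q A = \<lparr>
     obj = {(X, \<mu>). X \<in> objs Q \<and> distributor Q (star Q X) A \<mu>},
     otyp = fst,
     qhom = (\<lambda>(X, \<mu>) (X', \<mu>'). dist_rres Q (star Q X) (star Q X') A \<mu>' \<mu> ((), ()))\<rparr>"

definition yoneda :: "('o, 'a, 'x) qcat_data \<Rightarrow> 'x \<Rightarrow> 'o \<times> ('x \<times> unit \<Rightarrow> 'a)" where
  "yoneda A x = (otyp A x, \<lambda>(z, _) \<in> obj A \<times> {()}. qhom A z x)"

definition coyoneda :: "('o, 'a, 'x) qcat_data \<Rightarrow> 'x \<Rightarrow> 'o \<times> (unit \<times> 'x \<Rightarrow> 'a)" where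
  "coyoneda A x = (otyp A x, \<lambda>(_, z) \<in> {()} \<times> obj A. qhom A x z)"

text \<open>
  Suprema and infima are determined only up to isomorphism, so the following are predicates on
  functors rather than functions.
\<close>

definition is_sup :: "('o, 'a) quantaloid_data \<Rightarrow> ('o, 'a, 'x) qcat_data \<Rightarrow>
    ('o \<times> ('x \<times> unit \<Rightarrow> 'a) \<Rightarrow> 'x) \<Rightarrow> bool" where
  "is_sup Q A S \<longleftrightarrow> qadjoint Q (presheaves Q A) A S (yoneda A)"

definition is_inf :: "('o, 'a) quantaloid_data \<Rightarrow> ('o, 'a, 'x) qcat_data \<Rightarrow>
    ('o \<times> (unit \<times> 'x \<Rightarrow> 'a) \<Rightarrow> 'x) \<Rightarrow> bool" where
  "is_inf Q A I \<longleftrightarrow> qadjoint Q A (copresheaves Q A) (coyoneda A) I"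

definition qcomplete :: "('o, 'a) quantaloid_data \<Rightarrow> ('o, 'a, 'x) qcat_data \<Rightarrow> bool" where
  "qcomplete Q A \<longleftrightarrow> (\<exists>S. is_sup Q A S)"

definition ccd :: "('o, 'a) quantaloid_data \<Rightarrow> ('o, 'a, 'x) qcat_data \<Rightarrow> bool" where
  "ccd Q A \<longleftrightarrow> qcomplete Q A \<and>
     (\<exists>S T. is_sup Q A S \<and> qadjoint Q A (presheaves Q A) T S)"

definition op_ccd :: "('o, 'a) quantaloid_data \<Rightarrow> ('o, 'a, 'x) qcat_data \<Rightarrow> bool" where
  "op_ccd Q A \<longleftrightarrow> qcomplete Q A \<and>
     (\<exists>I T. is_inf Q A I \<and> qadjoint Q (copresheaves Q A) A I T)"

end

theory Submission
  imports Defs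
begin

text \<open>
  In a Girard quantaloid \<open>neg f = d \<swarrow> f\<close> is an order-reversing involution exchanging \<open>\<Q>(X, Y)\<close> and
  \<open>\<Q>(Y, X)\<close>, and it turns presheaves into copresheaves isomorphically. If \<open>T\<close> is left adjoint to
  \<open>sup\<close>, put \<open>G a = sup (neg A(a, -))\<close>, so that \<open>A(z, G a) = neg (T z a)\<close>. Then every copresheaf \<open>\<lambda>\<close>
  has the infimum \<open>sup (neg (\<lambda> (G -)))\<close>, and the right adjoint of \<open>inf\<close> sends \<open>z\<close> to the copresheaf
  \<open>b \<mapsto> \<Or>\<^sub>a A(G a, b) \<circ> neg A(a, z)\<close>. The converse is the same argument in the opposite quantaloid.
\<close>

section \<open>Order and residuals in a quantaloid\<close>

text \<open>Negation is a covariant isomorphism from presheaves to copresheaves, yet it carries the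
  chain \<open>T\<close> -| sup -| Yoneda to a chain that in general is not coyoneda -| inf -|
  \<open>R\<close>, since negated representables need not be corepresentable. \<open>G\<close>
  repairs this: the identity for A(z, G a) says that \<open>neg (T z)\<close> is the copresheaf A(z,
  -) restricted along \<open>G\<close>. The infimum is thus a composite: restrict along
  \<open>G\<close>, negate, take the supremum. Each factor has a right adjoint (Kan extension along
  \<open>G\<close>, negation, Yoneda), and composing these gives the formula for the right adjoint
  of inf. That the composite is itself right adjoint to coyoneda needs one more fact: the objects
  \<open>G a\<close> must suffice to test whether f \<le> A(z, x). This comes from T x \<le> A(-,
  x), the transpose of x \<le> sup A(-, x), because negation turns the tests into the condition that
  f composed with T z lies below T x.\<close>

lemma src_Homs: "f \<in> Homs Q X Y \<Longrightarrow> src Q f = X"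
  and tgt_Homs: "f \<in> Homs Q X Y \<Longrightarrow> tgt Q f = Y"
  by (simp_all add: Homs_def)

context quantaloid
begin

lemma Homs_objs:
  assumes "f \<in> Homs Q X Y"
  shows "X \<in> objs Q" and "Y \<in> objs Q"
  using assms src_objs tgt_objs by (auto simp: Homs_def)

lemma hom_complete_of: "f \<in> Homs Q X Y \<Longrightarrow> complete_lattice (hom_order Q X Y)"
  by (intro hom_complete Homs_objs)

lemma hom_refl: "f \<in> Homs Q X Y \<Longrightarrow> f \<preceq> f"
  using weak_partial_order.le_refl[of "hom_order Q X Y" f] hom_complete_of[of f X Y]
  by (simp add: hom_order_def complete_lattice_def partial_order_def)

lemma hom_trans:
  assumes "f \<preceq> g" "g \<preceq> h" "f \<in> Homs Q X Y" "g \<in> Homs Q X Y" "h \<in> Homs Q X Y"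
  shows "f \<preceq> h"
proof -
  interpret complete_lattice "hom_order Q X Y" using assms(3) by (rule hom_complete_of)
  show ?thesis using le_trans[of f g h] assms by (simp add: hom_order_def)
qed

lemma hom_antisym:
  assumes "f \<preceq> g" "g \<preceq> f" "f \<in> Homs Q X Y" "g \<in> Homs Q X Y"
  shows "f = g"
proof -
  interpret complete_lattice "hom_order Q X Y" using assms(3) by (rule hom_complete_of)
  show ?thesis using le_antisym[of f g] assms by (simp add: hom_order_def)
qed

text \<open>The order form of the Yoneda principle. Every equality of homs needed for an adjunction
  is later proved by comparing the arrows below both sides.\<close>

lemma hom_eqI:
  assumes "p \<in> Homs Q X Y" "q \<in> Homs Q X Y"
    and "\<And>f. f \<in> Homs Q X Y \<Longrightarrow> f \<preceq> p \<longleftrightarrow> f \<preceq> q"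
  shows "p = q"
  using assms by (intro hom_antisym[of p q X Y]) (auto intro: hom_refl)

lemma Sup_closed:
  assumes "X \<in> objs Q" "Y \<in> objs Q" "F \<subseteq> Homs Q X Y"
  shows "\<Squnion>\<^bsub>hom_order Q X Y\<^esub> F \<in> Homs Q X Y"
proof -
  interpret complete_lattice "hom_order Q X Y" using assms(1,2) by (rule hom_complete)
  show ?thesis using sup_closed[of F] assms by (simp add: hom_order_def)
qed

lemma Sup_le_iff:
  assumes "F \<subseteq> Homs Q X Y" "g \<in> Homs Q X Y"
  shows "\<Squnion>\<^bsub>hom_order Q X Y\<^esub> F \<preceq> g \<longleftrightarrow> (\<forall>f \<in> F. f \<preceq> g)"
proof -
  interpret complete_lattice "hom_order Q X Y" using assms(2) by (rule hom_complete_of)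
  have "\<Squnion>\<^bsub>hom_order Q X Y\<^esub> F \<preceq> g" if "\<forall>f \<in> F. f \<preceq> g"
    using sup_least[of F g] assms that by (simp add: hom_order_def)
  moreover have "f \<preceq> g" if "\<Squnion>\<^bsub>hom_order Q X Y\<^esub> F \<preceq> g" "f \<in> F" for f
  proof (rule hom_trans[of _ "\<Squnion>\<^bsub>hom_order Q X Y\<^esub> F" _ X Y])
    show "f \<preceq> \<Squnion>\<^bsub>hom_order Q X Y\<^esub> F"
      using sup_upper[of F f] assms that by (simp add: hom_order_def)
    show "\<Squnion>\<^bsub>hom_order Q X Y\<^esub> F \<in> Homs Q X Y"
      using sup_closed[of F] assms by (simp add: hom_order_def)
  qed (use assms that in auto)
  ultimately show ?thesis by blast
qed

lemma le_Sup:
  assumes "F \<subseteq> Homs Q X Y" "f \<in> F"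
  shows "f \<preceq> \<Squnion>\<^bsub>hom_order Q X Y\<^esub> F"
proof -
  have "f \<in> Homs Q X Y" using assms by auto
  then have "\<Squnion>\<^bsub>hom_order Q X Y\<^esub> F \<in> Homs Q X Y"
    using Sup_closed[OF Homs_objs] assms(1) by blast
  then show ?thesis using Sup_le_iff assms hom_refl by blast
qed

text \<open>Turns a comparison into a join, so that monotonicity of composition follows from
  preservation of joins.\<close>

lemma Sup_pair:
  assumes "f \<preceq> g" "f \<in> Homs Q X Y" "g \<in> Homs Q X Y"
  shows "\<Squnion>\<^bsub>hom_order Q X Y\<^esub> {f, g} = g"
proof (rule hom_antisym[of _ _ X Y])
  show "\<Squnion>\<^bsub>hom_order Q X Y\<^esub> {f, g} \<preceq> g"
    using assms hom_refl by (subst Sup_le_iff) auto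
  show "g \<preceq> \<Squnion>\<^bsub>hom_order Q X Y\<^esub> {f, g}" using assms by (intro le_Sup) auto
qed (use assms Homs_objs in \<open>auto intro!: Sup_closed\<close>)

lemma Sup_singleton:
  assumes "f \<in> Homs Q X Y"
  shows "\<Squnion>\<^bsub>hom_order Q X Y\<^esub> {f} = f"
  using Sup_pair[OF hom_refl[OF assms] assms assms] by simp

lemma comp_mono_right:
  assumes "f \<preceq> f'" "f \<in> Homs Q X Y" "f' \<in> Homs Q X Y" "g \<in> Homs Q Y Z"
  shows "g \<odot> f \<preceq> g \<odot> f'"
proof -
  have "g \<odot> f \<preceq> \<Squnion>\<^bsub>hom_order Q X Z\<^esub> ((\<lambda>f. g \<odot> f) ` {f, f'})"
    using assms by (intro le_Sup) (auto intro: comp_closed)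
  also have "\<dots> = g \<odot> (\<Squnion>\<^bsub>hom_order Q X Y\<^esub> {f, f'})"
    by (subst comp_Sup_right[where Z = Z]) (use assms Homs_objs in auto)
  finally show ?thesis using Sup_pair[OF assms(1-3)] by simp
qed

lemma comp_mono_left:
  assumes "g \<preceq> g'" "f \<in> Homs Q X Y" "g \<in> Homs Q Y Z" "g' \<in> Homs Q Y Z"
  shows "g \<odot> f \<preceq> g' \<odot> f"
proof -
  have "g \<odot> f \<preceq> \<Squnion>\<^bsub>hom_order Q X Z\<^esub> ((\<lambda>g. g \<odot> f) ` {g, g'})"
    using assms by (intro le_Sup) (auto intro: comp_closed)
  also have "\<dots> = (\<Squnion>\<^bsub>hom_order Q Y Z\<^esub> {g, g'}) \<odot> f"
    by (subst comp_Sup_left[where X = X]) (use assms Homs_objs in auto)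
  finally show ?thesis using Sup_pair[OF assms(1,3,4)] by simp
qed

lemma Sup_comp_le_iff:
  assumes "I \<subseteq> Homs Q Y Z" "f \<in> Homs Q X Y" "h \<in> Homs Q X Z"
  shows "(\<Squnion>\<^bsub>hom_order Q Y Z\<^esub> I) \<odot> f \<preceq> h \<longleftrightarrow> (\<forall>g \<in> I. g \<odot> f \<preceq> h)"
proof -
  have "(\<Squnion>\<^bsub>hom_order Q Y Z\<^esub> I) \<odot> f = \<Squnion>\<^bsub>hom_order Q X Z\<^esub> ((\<lambda>g. g \<odot> f) ` I)"
    using assms Homs_objs by (intro comp_Sup_left) auto
  moreover have "(\<lambda>g. g \<odot> f) ` I \<subseteq> Homs Q X Z" using assms comp_closed by auto
  ultimately show ?thesis using Sup_le_iff assms(3) by simp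
qed

lemma comp_Sup_le_iff:
  assumes "F \<subseteq> Homs Q X Y" "g \<in> Homs Q Y Z" "h \<in> Homs Q X Z"
  shows "g \<odot> (\<Squnion>\<^bsub>hom_order Q X Y\<^esub> F) \<preceq> h \<longleftrightarrow> (\<forall>f \<in> F. g \<odot> f \<preceq> h)"
proof -
  have "g \<odot> (\<Squnion>\<^bsub>hom_order Q X Y\<^esub> F) = \<Squnion>\<^bsub>hom_order Q X Z\<^esub> ((\<lambda>f. g \<odot> f) ` F)"
    using assms Homs_objs by (intro comp_Sup_right) auto
  moreover have "(\<lambda>f. g \<odot> f) ` F \<subseteq> Homs Q X Z" using assms comp_closed by auto
  ultimately show ?thesis using Sup_le_iff assms(3) by simp
qed

text \<open>The join of all solutions \<open>g\<close> is again a solution because composition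
  preserves joins on the left. The sources \<open>W i\<close> may vary: a one-element family gives
  \<open>lres\<close>, and a family over \<open>obj A\<close> gives the homs between
  presheaves.\<close>

lemma residual_exists:
  assumes "Y \<in> objs Q" "Z \<in> objs Q"
    and "\<And>i. i \<in> I \<Longrightarrow> m i \<in> Homs Q (W i) Y" "\<And>i. i \<in> I \<Longrightarrow> h i \<in> Homs Q (W i) Z"
  obtains r where "r \<in> Homs Q Y Z"
    and "\<And>g. g \<in> Homs Q Y Z \<Longrightarrow> g \<preceq> r \<longleftrightarrow> (\<forall>i \<in> I. g \<odot> m i \<preceq> h i)"
proof -
  let ?F = "{g \<in> Homs Q Y Z. \<forall>i \<in> I. g \<odot> m i \<preceq> h i}"
  let ?r = "\<Squnion>\<^bsub>hom_order Q Y Z\<^esub> ?F"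
  have r: "?r \<in> Homs Q Y Z" using assms(1,2) by (intro Sup_closed) auto
  have le: "?r \<odot> m i \<preceq> h i" if "i \<in> I" for i
    using Sup_comp_le_iff[of ?F Y Z "m i" "W i" "h i"] assms that by auto
  have "g \<preceq> ?r \<longleftrightarrow> (\<forall>i \<in> I. g \<odot> m i \<preceq> h i)" if g: "g \<in> Homs Q Y Z" for g
  proof
    assume "g \<preceq> ?r"
    show "\<forall>i \<in> I. g \<odot> m i \<preceq> h i"
    proof
      fix i assume i: "i \<in> I"
      have "g \<odot> m i \<preceq> ?r \<odot> m i" using comp_mono_left[OF \<open>g \<preceq> ?r\<close> assms(3)[OF i] g r] .
      from hom_trans[OF this le[OF i] comp_closed comp_closed assms(4)[OF i]]
      show "g \<odot> m i \<preceq> h i" using assms(3)[OF i] g r by blast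
    qed
  next
    assume "\<forall>i \<in> I. g \<odot> m i \<preceq> h i"
    then show "g \<preceq> ?r" using g by (intro le_Sup) auto
  qed
  then show ?thesis using that r by blast
qed

lemma lres_residual:
  assumes "f \<in> Homs Q X Y" "h \<in> Homs Q X Z"
  shows "lres Q h f \<in> Homs Q Y Z"
    and "g \<in> Homs Q Y Z \<Longrightarrow> g \<preceq> lres Q h f \<longleftrightarrow> g \<odot> f \<preceq> h"
proof -
  obtain r where r: "r \<in> Homs Q Y Z" "\<And>g. g \<in> Homs Q Y Z \<Longrightarrow> g \<preceq> r \<longleftrightarrow> g \<odot> f \<preceq> h"
    using residual_exists[of Y Z "{()}" "\<lambda>_. f" "\<lambda>_. X" "\<lambda>_. h"] assms Homs_objs by auto
  have "lres Q h f = r"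
    unfolding lres_def tgt_Homs[OF assms(1)] tgt_Homs[OF assms(2)]
  proof (rule the_equality)
    fix r' assume r': "r' \<in> Homs Q Y Z \<and> (\<forall>g \<in> Homs Q Y Z. g \<odot> f \<preceq> h \<longleftrightarrow> g \<preceq> r')"
    then show "r' = r" using r by (intro hom_eqI[of _ Y Z]) auto
  qed (use r in auto)
  then show "lres Q h f \<in> Homs Q Y Z"
    and "g \<in> Homs Q Y Z \<Longrightarrow> g \<preceq> lres Q h f \<longleftrightarrow> g \<odot> f \<preceq> h"
    using r by auto
qed

end

section \<open>Opposite quantaloids and opposite categories\<close>

text \<open>Only the direction of arrows is reversed; the order \<open>qle\<close> is kept. The
  arrows stay the same elements, so the double opposite is literally \<open>Q\<close> and dual
  statements need no transport.\<close>

definition op_quantaloid :: "('o, 'a) quantaloid_data \<Rightarrow> ('o, 'a) quantaloid_data" where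
  "op_quantaloid Q = \<lparr>objs = objs Q, arrs = arrs Q, src = tgt Q, tgt = src Q,
     qcomp = (\<lambda>f g. g \<odot>\<^bsub>Q\<^esub> f), qid = qid Q, qle = qle Q\<rparr>"

definition op_qcat :: "('o, 'a, 'x) qcat_data \<Rightarrow> ('o, 'a, 'x) qcat_data" where
  "op_qcat A = \<lparr>obj = obj A, otyp = otyp A, qhom = (\<lambda>x y. qhom A y x)\<rparr>"

lemma op_quantaloid_simps [simp]:
  "objs (op_quantaloid Q) = objs Q"
  "arrs (op_quantaloid Q) = arrs Q"
  "src (op_quantaloid Q) = tgt Q"
  "tgt (op_quantaloid Q) = src Q"
  "f \<odot>\<^bsub>op_quantaloid Q\<^esub> g = g \<odot>\<^bsub>Q\<^esub> f"
  "qid (op_quantaloid Q) = qid Q"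
  "qle (op_quantaloid Q) = qle Q"
  "op_quantaloid (op_quantaloid Q) = Q"
  by (simp_all add: op_quantaloid_def)

lemma op_qcat_simps [simp]:
  "obj (op_qcat A) = obj A"
  "otyp (op_qcat A) = otyp A"
  "qhom (op_qcat A) x y = qhom A y x"
  "op_qcat (op_qcat A) = A"
  by (simp_all add: op_qcat_def)

lemma Homs_op [simp]: "Homs (op_quantaloid Q) X Y = Homs Q Y X"
  by (auto simp: Homs_def)

lemma hom_order_op [simp]: "hom_order (op_quantaloid Q) X Y = hom_order Q Y X"
  by (simp add: hom_order_def)

lemma lres_op [simp]: "lres (op_quantaloid Q) h f = rres Q f h"
  and rres_op [simp]: "rres (op_quantaloid Q) f h = lres Q h f"
  by (simp_all add: lres_def rres_def)

lemma quantaloid_op: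
  assumes "quantaloid Q"
  shows "quantaloid (op_quantaloid Q)"
proof -
  interpret quantaloid Q by fact
  show ?thesis
    by (intro quantaloid.intro)
      (auto simp: src_objs tgt_objs id_closed id_left id_right hom_complete comp_Sup_left
        comp_Sup_right comp_assoc intro: comp_closed)
qed

lemma girard_quantaloid_op:
  assumes "girard_quantaloid Q d"
  shows "girard_quantaloid (op_quantaloid Q) d"
proof -
  interpret girard_quantaloid Q d by fact
  show ?thesis
    by (intro girard_quantaloid.intro girard_quantaloid_axioms.intro quantaloid_op)
      (auto simp: d_closed dualizing_left dualizing_right quantaloid_axioms intro: cyclic[symmetric])
qed

lemma qfunctor_op [simp]:
  "qfunctor (op_quantaloid Q) (op_qcat A) (op_qcat B) F \<longleftrightarrow> qfunctor Q A B F"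
  by (auto simp: qfunctor_def)

lemma underlying_le_op [simp]:
  "underlying_le (op_quantaloid Q) (op_qcat A) x y \<longleftrightarrow> underlying_le Q A y x"
  by (auto simp: underlying_le_def)

text \<open>Reversing homs keeps functors but reverses the underlying order, so the unit and the
  counit trade places.\<close>

lemma qadjoint_op:
  "qadjoint (op_quantaloid Q) (op_qcat B) (op_qcat A) G F \<longleftrightarrow> qadjoint Q A B F G"
  by (auto simp: qadjoint_def)

lemma qcategory_op:
  assumes "quantaloid Q" "qcategory Q A"
  shows "qcategory (op_quantaloid Q) (op_qcat A)"
  using assms by (auto simp: qcategory_def)

section \<open>Adjunctions and categories of presheaves\<close>

lemma qcat_typ: "qcategory Q A \<Longrightarrow> x \<in> obj A \<Longrightarrow> otyp A x \<in> objs Q"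
  and qcat_hom: "qcategory Q A \<Longrightarrow> x \<in> obj A \<Longrightarrow> y \<in> obj A \<Longrightarrow>
    qhom A x y \<in> Homs Q (otyp A x) (otyp A y)"
  and qcat_id: "qcategory Q A \<Longrightarrow> x \<in> obj A \<Longrightarrow> qid Q (otyp A x) \<preceq>\<^bsub>Q\<^esub> qhom A x x"
  and qcat_comp: "qcategory Q A \<Longrightarrow> x \<in> obj A \<Longrightarrow> y \<in> obj A \<Longrightarrow> z \<in> obj A \<Longrightarrow>
    qhom A y z \<odot>\<^bsub>Q\<^esub> qhom A x y \<preceq>\<^bsub>Q\<^esub> qhom A x z"
  by (auto simp: qcategory_def)

text \<open>The action of \<open>star Q X\<close> is composition with an identity, so only the
  action of \<open>A\<close> remains. Extensionality is dropped, which lets presheaves be given by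
  arbitrary functions.\<close>

definition presheaf ::
  "('o, 'a) quantaloid_data \<Rightarrow> ('o, 'a, 'x) qcat_data \<Rightarrow> 'o \<Rightarrow> ('x \<Rightarrow> 'a) \<Rightarrow> bool" where
  "presheaf Q A X m \<longleftrightarrow>
     (\<forall>a \<in> obj A. m a \<in> Homs Q (otyp A a) X) \<and>
     (\<forall>a \<in> obj A. \<forall>b \<in> obj A. m b \<odot>\<^bsub>Q\<^esub> qhom A a b \<preceq>\<^bsub>Q\<^esub> m a)"

text \<open>
  \<open>C\<close> is a presheaf category of \<open>A\<close> with evaluation \<open>ev\<close>. Distinct objects of \<open>C\<close> may have the same
  components. Up to the choice of \<open>ev\<close>, the opposite of the copresheaf category of \<open>A\<close> is then a
  presheaf category of the opposite of \<open>A\<close>, with no transport along an isomorphism.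
\<close>

definition presents_presheaves :: "('o, 'a) quantaloid_data \<Rightarrow> ('o, 'a, 'x) qcat_data \<Rightarrow>
    ('o, 'a, 'u) qcat_data \<Rightarrow> ('u \<Rightarrow> 'x \<Rightarrow> 'a) \<Rightarrow> bool" where
  "presents_presheaves Q A C ev \<longleftrightarrow>
     (\<forall>u \<in> obj C. otyp C u \<in> objs Q \<and> presheaf Q A (otyp C u) (ev u)) \<and>
     (\<forall>X \<in> objs Q. \<forall>m. presheaf Q A X m \<longrightarrow>
        (\<exists>u \<in> obj C. otyp C u = X \<and> (\<forall>a \<in> obj A. ev u a = m a))) \<and>
     (\<forall>u \<in> obj C. \<forall>v \<in> obj C. qhom C u v \<in> Homs Q (otyp C u) (otyp C v) \<and>
        (\<forall>f \<in> Homs Q (otyp C u) (otyp C v).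
           f \<preceq>\<^bsub>Q\<^esub> qhom C u v \<longleftrightarrow> (\<forall>a \<in> obj A. f \<odot>\<^bsub>Q\<^esub> ev u a \<preceq>\<^bsub>Q\<^esub> ev v a)))"

definition is_yoneda :: "('o, 'a, 'x) qcat_data \<Rightarrow> ('o, 'a, 'u) qcat_data \<Rightarrow>
    ('u \<Rightarrow> 'x \<Rightarrow> 'a) \<Rightarrow> ('x \<Rightarrow> 'u) \<Rightarrow> bool" where
  "is_yoneda A C ev y \<longleftrightarrow> (\<forall>z \<in> obj A. y z \<in> obj C \<and> otyp C (y z) = otyp A z \<and>
     (\<forall>a \<in> obj A. ev (y z) a = qhom A a z))"

lemma presents_presheavesD:
  assumes "presents_presheaves Q A C ev"
  shows "u \<in> obj C \<Longrightarrow> otyp C u \<in> objs Q"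
    and "u \<in> obj C \<Longrightarrow> a \<in> obj A \<Longrightarrow> ev u a \<in> Homs Q (otyp A a) (otyp C u)"
    and "u \<in> obj C \<Longrightarrow> a \<in> obj A \<Longrightarrow> b \<in> obj A \<Longrightarrow> ev u b \<odot>\<^bsub>Q\<^esub> qhom A a b \<preceq>\<^bsub>Q\<^esub> ev u a"
    and "u \<in> obj C \<Longrightarrow> v \<in> obj C \<Longrightarrow> qhom C u v \<in> Homs Q (otyp C u) (otyp C v)"
    and "u \<in> obj C \<Longrightarrow> v \<in> obj C \<Longrightarrow> f \<in> Homs Q (otyp C u) (otyp C v) \<Longrightarrow>
      f \<preceq>\<^bsub>Q\<^esub> qhom C u v \<longleftrightarrow> (\<forall>a \<in> obj A. f \<odot>\<^bsub>Q\<^esub> ev u a \<preceq>\<^bsub>Q\<^esub> ev v a)"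
  using assms by (auto simp: presents_presheaves_def presheaf_def)

lemma presents_presheaves_obtain:
  assumes "presents_presheaves Q A C ev" "X \<in> objs Q"
    and "\<And>a. a \<in> obj A \<Longrightarrow> m a \<in> Homs Q (otyp A a) X"
    and "\<And>a b. a \<in> obj A \<Longrightarrow> b \<in> obj A \<Longrightarrow> m b \<odot>\<^bsub>Q\<^esub> qhom A a b \<preceq>\<^bsub>Q\<^esub> m a"
  shows "\<exists>u \<in> obj C. otyp C u = X \<and> (\<forall>a \<in> obj A. ev u a = m a)"
  using assms by (auto simp: presents_presheaves_def presheaf_def)

context quantaloid
begin

lemma qhom_antimono:
  assumes A: "qcategory Q A" "x \<in> obj A" "y \<in> obj A" "z \<in> obj A" and le: "underlying_le Q A x y"
  shows "qhom A y z \<preceq> qhom A x z"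
proof -
  have h: "qhom A y z \<in> Homs Q (otyp A x) (otyp A z)" "qhom A x y \<in> Homs Q (otyp A x) (otyp A x)"
    "qhom A x z \<in> Homs Q (otyp A x) (otyp A z)"
    using qcat_hom[OF A(1)] A le by (auto simp: underlying_le_def) metis+
  have "qhom A y z \<odot> qid Q (otyp A x) \<preceq> qhom A y z \<odot> qhom A x y"
    using h le A qcat_typ[OF A(1)] by (intro comp_mono_right) (auto simp: underlying_le_def id_closed)
  then have "qhom A y z \<preceq> qhom A y z \<odot> qhom A x y" using h by (simp add: id_right)
  from hom_trans[OF this qcat_comp[OF A(1-4)] h(1) comp_closed[OF h(2,1)] h(3)]
  show ?thesis .
qed

lemma qhom_mono:
  assumes A: "qcategory Q A" "x \<in> obj A" "y \<in> obj A" "z \<in> obj A" and le: "underlying_le Q A y z"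
  shows "qhom A x y \<preceq> qhom A x z"
proof -
  interpret op: quantaloid "op_quantaloid Q" by (rule quantaloid_op) unfold_locales
  show ?thesis
    using op.qhom_antimono[of "op_qcat A" z y x] assms qcategory_op[OF quantaloid_axioms A(1)] by simp
qed

text \<open>Forward, four inequalities form a cycle: apply \<open>G\<close>, precompose with the
  unit, apply \<open>F\<close>, postcompose with the counit. Backward, evaluating the hom equality
  at identities gives unit and counit, and these yield functoriality: A(x, x') \<le> A(x, G (F x'))
  = B(F x, F x'). Hence the adjunctions constructed below need only object maps and an equality of
  homs.\<close>

lemma qadjoint_iff_hom:
  assumes A: "qcategory Q A" and B: "qcategory Q B"
  shows "qadjoint Q A B F G \<longleftrightarrow>
     (\<forall>x \<in> obj A. F x \<in> obj B \<and> otyp B (F x) = otyp A x) \<and>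
     (\<forall>y \<in> obj B. G y \<in> obj A \<and> otyp A (G y) = otyp B y) \<and>
     (\<forall>x \<in> obj A. \<forall>y \<in> obj B. qhom B (F x) y = qhom A x (G y))" (is "_ \<longleftrightarrow> ?R")
proof
  assume adj: "qadjoint Q A B F G"
  have F: "F x \<in> obj B" "otyp B (F x) = otyp A x" if "x \<in> obj A" for x
    using adj that by (auto simp: qadjoint_def qfunctor_def)
  have G: "G y \<in> obj A" "otyp A (G y) = otyp B y" if "y \<in> obj B" for y
    using adj that by (auto simp: qadjoint_def qfunctor_def)
  have "qhom B (F x) y = qhom A x (G y)" if x: "x \<in> obj A" and y: "y \<in> obj B" for x y
  proof -
    have h: "qhom B (F x) y \<in> Homs Q (otyp A x) (otyp B y)"
      "qhom A x (G y) \<in> Homs Q (otyp A x) (otyp B y)"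
      "qhom A (G (F x)) (G y) \<in> Homs Q (otyp A x) (otyp B y)"
      "qhom B (F x) (F (G y)) \<in> Homs Q (otyp A x) (otyp B y)"
      using qcat_hom[OF B, of "F x" y] qcat_hom[OF A, of x "G y"]
        qcat_hom[OF A, of "G (F x)" "G y"] qcat_hom[OF B, of "F x" "F (G y)"] F G x y by simp_all
    have "qhom B (F x) y \<preceq> qhom A (G (F x)) (G y)"
      using adj F G x y by (auto simp: qadjoint_def qfunctor_def)
    moreover have "qhom A (G (F x)) (G y) \<preceq> qhom A x (G y)"
      using adj F G x y by (intro qhom_antimono A) (auto simp: qadjoint_def)
    moreover have "qhom A x (G y) \<preceq> qhom B (F x) (F (G y))"
      using adj F G x y by (auto simp: qadjoint_def qfunctor_def)
    moreover have "qhom B (F x) (F (G y)) \<preceq> qhom B (F x) y"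
      using adj F G x y by (intro qhom_mono B) (auto simp: qadjoint_def)
    ultimately show ?thesis
      using h by (intro hom_antisym[of _ _ "otyp A x" "otyp B y"]) (auto intro: hom_trans)
  qed
  then show ?R using F G by blast
next
  assume R: ?R
  then have F: "F x \<in> obj B" "otyp B (F x) = otyp A x" if "x \<in> obj A" for x
    using that by auto
  from R have G: "G y \<in> obj A" "otyp A (G y) = otyp B y" if "y \<in> obj B" for y
    using that by auto
  from R have hom: "qhom B (F x) y = qhom A x (G y)" if "x \<in> obj A" "y \<in> obj B" for x y
    using that by auto
  have unit: "underlying_le Q A x (G (F x))" if "x \<in> obj A" for x
    using qcat_id[OF B, of "F x"] F G hom[of x "F x"] that by (simp add: underlying_le_def)
  have counit: "underlying_le Q B (F (G y)) y" if "y \<in> obj B" for y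
    using qcat_id[OF A, of "G y"] F G hom[of "G y" y] that by (simp add: underlying_le_def)
  have "qhom A x x' \<preceq> qhom B (F x) (F x')" if "x \<in> obj A" "x' \<in> obj A" for x x'
    using qhom_mono[OF A, of x x' "G (F x')"] unit hom[of x "F x'"] F G that by simp
  moreover have "qhom B y y' \<preceq> qhom A (G y) (G y')" if "y \<in> obj B" "y' \<in> obj B" for y y'
    using qhom_antimono[OF B, of "F (G y)" y y'] counit hom[of "G y" y'] F G that by simp
  ultimately show "qadjoint Q A B F G"
    using unit counit F G by (auto simp: qadjoint_def qfunctor_def)
qed

text \<open>The hom from \<open>u\<close> to \<open>v\<close> is the largest arrow carrying
  \<open>ev u\<close> below \<open>ev v\<close>; identities do this for \<open>u = v\<close>, and
  composites of such arrows do it again.\<close>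

lemma presents_presheaves_qcategory:
  assumes P: "presents_presheaves Q A C ev"
  shows "qcategory Q C"
proof -
  note C = presents_presheavesD[OF P]
  have "qid Q (otyp C u) \<preceq> qhom C u u" if u: "u \<in> obj C" for u
  proof -
    have "qid Q (otyp C u) \<odot> ev u a \<preceq> ev u a" if "a \<in> obj A" for a
      using C(2)[OF u that] by (simp add: id_left hom_refl)
    then show ?thesis using C(5)[OF u u id_closed] C(1) u by blast
  qed
  moreover have "qhom C v w \<odot> qhom C u v \<preceq> qhom C u w"
    if u: "u \<in> obj C" and v: "v \<in> obj C" and w: "w \<in> obj C" for u v w
  proof -
    note uv = C(4)[OF u v] and vw = C(4)[OF v w]
    have "(qhom C v w \<odot> qhom C u v) \<odot> ev u a \<preceq> ev w a" if a: "a \<in> obj A" for a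
    proof -
      note au = C(2)[OF u a] and av = C(2)[OF v a] and aw = C(2)[OF w a]
      have 1: "qhom C u v \<odot> ev u a \<preceq> ev v a" using C(5)[OF u v uv] hom_refl[OF uv] a by blast
      have 2: "qhom C v w \<odot> ev v a \<preceq> ev w a" using C(5)[OF v w vw] hom_refl[OF vw] a by blast
      have "qhom C v w \<odot> (qhom C u v \<odot> ev u a) \<preceq> qhom C v w \<odot> ev v a"
        by (rule comp_mono_right[OF 1 comp_closed[OF au uv] av vw])
      from hom_trans[OF this 2 comp_closed[OF comp_closed[OF au uv] vw] comp_closed[OF av vw] aw]
      show ?thesis using comp_assoc[OF au uv vw] by simp
    qed
    then show ?thesis using C(5)[OF u w comp_closed[OF uv vw]] by blast
  qed
  ultimately show ?thesis using C(1,4) by (auto simp: qcategory_def)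
qed

end

section \<open>Negation in a Girard quantaloid\<close>

context girard_quantaloid
begin

definition neg :: "'a \<Rightarrow> 'a" where
  "neg f = lres Q (d (src Q f)) f"

lemma neg_closed: "f \<in> Homs Q X Y \<Longrightarrow> neg f \<in> Homs Q Y X"
  unfolding neg_def by (simp add: src_Homs lres_residual(1) d_closed Homs_objs)

lemma le_neg_iff_left:
  assumes "f \<in> Homs Q X Y" "g \<in> Homs Q Y X"
  shows "g \<preceq> neg f \<longleftrightarrow> g \<odot> f \<preceq> d X"
  using lres_residual(2)[OF assms(1) d_closed assms(2)] assms Homs_objs
  by (simp add: neg_def src_Homs)

text \<open>Cyclicity makes \<open>neg f\<close> also the right residual of \<open>d Y\<close> by
  \<open>f\<close>, and right residuals are left residuals of the opposite quantaloid.\<close>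

lemma le_neg_iff_right:
  assumes f: "f \<in> Homs Q X Y" and g: "g \<in> Homs Q Y X"
  shows "g \<preceq> neg f \<longleftrightarrow> f \<odot> g \<preceq> d Y"
proof -
  interpret op: quantaloid "op_quantaloid Q" by (rule quantaloid_op) unfold_locales
  have "neg f = rres Q f (d Y)" using cyclic[OF f] f by (simp add: neg_def src_Homs)
  then show ?thesis
    using op.lres_residual(2)[of f Y X "d Y" Y g] f g d_closed[of Y] Homs_objs[OF f] by simp
qed

lemma neg_neg:
  assumes "f \<in> Homs Q X Y"
  shows "neg (neg f) = f"
proof -
  have "neg (neg f) = lres Q (d Y) (neg f)"
    using src_Homs[OF neg_closed[OF assms]] by (simp add: neg_def)
  moreover have "neg f = rres Q f (d Y)"
    using cyclic[OF assms] assms by (simp add: neg_def src_Homs)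
  ultimately show ?thesis using dualizing_right[OF assms] by simp
qed

text \<open>Both sides say that the triple composite of \<open>m\<close>, \<open>f\<close> and
  \<open>neg m'\<close> lies below \<open>d W\<close>, bracketed in the two possible ways. Applied
  componentwise, this makes negation an isomorphism on homs between presheaves and
  copresheaves.\<close>

lemma neg_transpose:
  assumes f: "f \<in> Homs Q X Y" and m: "m \<in> Homs Q W X" and m': "m' \<in> Homs Q W Y"
  shows "f \<odot> m \<preceq> m' \<longleftrightarrow> neg m' \<odot> f \<preceq> neg m"
proof -
  have "f \<odot> m \<preceq> m' \<longleftrightarrow> neg m' \<odot> (f \<odot> m) \<preceq> d W"
    using le_neg_iff_right[OF neg_closed[OF m'] comp_closed[OF m f]] neg_neg[OF m'] by simp
  also have "neg m' \<odot> (f \<odot> m) = (neg m' \<odot> f) \<odot> m"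
    using comp_assoc[OF m f neg_closed[OF m']] by simp
  also have "\<dots> \<preceq> d W \<longleftrightarrow> neg m' \<odot> f \<preceq> neg m"
    using le_neg_iff_left[OF m comp_closed[OF f neg_closed[OF m']]] by simp
  finally show ?thesis .
qed

text \<open>Negating a presheaf yields a copresheaf: the contravariant action inequality becomes the
  covariant one. \<open>neg_action_op\<close> is the passage back.\<close>

lemma neg_action:
  assumes "h \<in> Homs Q X Y" "m \<in> Homs Q X Z" "m' \<in> Homs Q Y Z"
    and "m' \<odot> h \<preceq> m"
  shows "h \<odot> neg m \<preceq> neg m'"
  using neg_transpose[OF assms(1) neg_closed[OF assms(2)] neg_closed[OF assms(3)]] assms neg_neg
  by simp

lemma neg_action_op:
  assumes "h \<in> Homs Q X Y" "m \<in> Homs Q Z X" "m' \<in> Homs Q Z Y"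
    and "h \<odot> m \<preceq> m'"
  shows "neg m' \<odot> h \<preceq> neg m"
  using neg_transpose[OF assms(1-3)] assms(4) by simp

end

section \<open>From suprema to infima\<close>

text \<open>\<open>D\<close> stands for the opposite of the copresheaf category, so read in
  \<open>Q\<close> the conclusion is the chain \<open>yD\<close> -| \<open>I\<close> -|
  \<open>R\<close>. Stating it through opposites, for any \<open>C\<close> and \<open>D\<close>
  presenting presheaves, makes the converse an instance with the two categories exchanged.\<close>

lemma (in girard_quantaloid) sup_left_adjoint_imp_inf_right_adjoint:
  assumes A: "qcategory Q A"
    and C: "presents_presheaves Q A C ev" and yC: "is_yoneda A C ev yC"
    and D: "presents_presheaves (op_quantaloid Q) (op_qcat A) D cv"
    and yD: "is_yoneda (op_qcat A) D cv yD"
    and S: "qadjoint Q C A S yC" and T: "qadjoint Q A C T S"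
  shows "\<exists>I R. qadjoint (op_quantaloid Q) D (op_qcat A) I yD \<and>
    qadjoint (op_quantaloid Q) (op_qcat A) D R I"
proof -
  interpret op: quantaloid "op_quantaloid Q" by (rule quantaloid_op) unfold_locales
  note Cat = presents_presheaves_qcategory[OF C]
  note Dat = op.presents_presheaves_qcategory[OF D]
  note Aop = qcategory_op[OF quantaloid_axioms A]
  note A_typ = qcat_typ[OF A] and hom = qcat_hom[OF A]
  note Sadj = S[unfolded qadjoint_iff_hom[OF Cat A]]
  note Tadj = T[unfolded qadjoint_iff_hom[OF A Cat]]
  note ev_hom = presents_presheavesD(2)[OF C] and ev_action = presents_presheavesD(3)[OF C]
    and le_C_iff = presents_presheavesD(5)[OF C]
  note D_typ = presents_presheavesD(1)[OF D, simplified]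
    and cv_hom = presents_presheavesD(2)[OF D, simplified]
    and cv_action = presents_presheavesD(3)[OF D, simplified]
    and D_hom = presents_presheavesD(4)[OF D, simplified]
    and le_D_iff = presents_presheavesD(5)[OF D, simplified]
  have yC_obj: "yC z \<in> obj C" "otyp C (yC z) = otyp A z" if "z \<in> obj A" for z
    using yC that by (auto simp: is_yoneda_def)
  have yC_ev: "ev (yC z) a = qhom A a z" if "z \<in> obj A" "a \<in> obj A" for z a
    using yC that by (auto simp: is_yoneda_def)
  have yD_obj: "yD z \<in> obj D" "otyp D (yD z) = otyp A z" if "z \<in> obj A" for z
    using yD that by (auto simp: is_yoneda_def)
  have yD_cv: "cv (yD z) a = qhom A z a" if "z \<in> obj A" "a \<in> obj A" for z a
    using yD that by (auto simp: is_yoneda_def)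
  have S_obj: "S u \<in> obj A" "otyp A (S u) = otyp C u" if "u \<in> obj C" for u
    using Sadj that by auto
  have T_obj: "T z \<in> obj C" "otyp C (T z) = otyp A z" if "z \<in> obj A" for z
    using Tadj that by auto
  have S_adj: "qhom A (S u) z = qhom C u (yC z)" if "u \<in> obj C" "z \<in> obj A" for u z
    using Sadj that by auto
  have T_adj: "qhom A z (S u) = qhom C (T z) u" if "u \<in> obj C" "z \<in> obj A" for u z
    using Tadj that by auto
  have T_hom: "ev (T z) a \<in> Homs Q (otyp A a) (otyp A z)" if "z \<in> obj A" "a \<in> obj A" for z a
    using ev_hom[of "T z" a] T_obj that by simp

  \<comment> \<open>The objects \<open>G a\<close> and the homs into them\<close>
  have "\<exists>g. \<forall>a \<in> obj A. g a \<in> obj C \<and> otyp C (g a) = otyp A a \<and>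
      (\<forall>b \<in> obj A. ev (g a) b = neg (qhom A a b))"
  proof (intro bchoice ballI)
    fix a assume a: "a \<in> obj A"
    have "\<exists>u \<in> obj C. otyp C u = otyp A a \<and> (\<forall>b \<in> obj A. ev u b = neg (qhom A a b))"
      using a hom qcat_comp[OF A]
      by (intro presents_presheaves_obtain[OF C] A_typ neg_closed neg_action_op) auto
    then show "\<exists>u. u \<in> obj C \<and> otyp C u = otyp A a \<and> (\<forall>b \<in> obj A. ev u b = neg (qhom A a b))"
      by blast
  qed
  then obtain g where g: "g a \<in> obj C" "otyp C (g a) = otyp A a"
    and g_ev: "b \<in> obj A \<Longrightarrow> ev (g a) b = neg (qhom A a b)" if "a \<in> obj A" for a b
    by blast
  define G where "G a = S (g a)" for a
  have G: "G a \<in> obj A" "otyp A (G a) = otyp A a" if "a \<in> obj A" for a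
    using S_obj g that by (auto simp: G_def)
  have G_hom: "qhom A z (G a) \<in> Homs Q (otyp A z) (otyp A a)"
      "qhom A (G a) z \<in> Homs Q (otyp A a) (otyp A z)"
    if "z \<in> obj A" "a \<in> obj A" for z a
    using hom[of z "G a"] hom[of "G a" z] G that by auto
  have negT_hom: "neg (ev (T z) a) \<in> Homs Q (otyp A z) (otyp A a)"
    if "z \<in> obj A" "a \<in> obj A" for z a
    using neg_closed T_hom that by blast
  have negT_action: "qhom A a b \<odot> neg (ev (T z) a) \<preceq> neg (ev (T z) b)"
    if "z \<in> obj A" "a \<in> obj A" "b \<in> obj A" for z a b
    using that T_obj by (intro neg_action[OF hom T_hom T_hom ev_action]) auto

  \<comment> \<open>Since \<open>T\<close> is left adjoint to \<open>S\<close>, the left side is the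
    presheaf hom from \<open>T z\<close> to the negation of A(a, -). Negating both turns it into a
    hom from A(a, -) to \<open>neg (T z)\<close>, which the Yoneda lemma evaluates at
    \<open>a\<close>.\<close>
  have hom_G: "qhom A z (G a) = neg (ev (T z) a)" if z: "z \<in> obj A" and a: "a \<in> obj A" for z a
  proof (rule hom_eqI[of _ "otyp A z" "otyp A a"])
    show "qhom A z (G a) \<in> Homs Q (otyp A z) (otyp A a)" using G_hom z a by blast
    show "neg (ev (T z) a) \<in> Homs Q (otyp A z) (otyp A a)" using negT_hom z a by blast
    fix f assume f: "f \<in> Homs Q (otyp A z) (otyp A a)"
    have "f \<preceq> qhom A z (G a) \<longleftrightarrow> f \<preceq> qhom C (T z) (g a)"
      using T_adj g z a by (simp add: G_def)
    also have "\<dots> \<longleftrightarrow> (\<forall>b \<in> obj A. f \<odot> ev (T z) b \<preceq> neg (qhom A a b))"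
      using le_C_iff[of "T z" "g a" f] T_obj g g_ev z a f by simp
    also have "\<dots> \<longleftrightarrow> (\<forall>b \<in> obj A. qhom A a b \<odot> f \<preceq> neg (ev (T z) b))"
    proof (intro ball_cong refl)
      fix b assume b: "b \<in> obj A"
      show "f \<odot> ev (T z) b \<preceq> neg (qhom A a b) \<longleftrightarrow> qhom A a b \<odot> f \<preceq> neg (ev (T z) b)"
        using neg_transpose[OF f T_hom[OF z b] neg_closed[OF hom[OF a b]]] neg_neg[OF hom[OF a b]]
        by simp
    qed
    \<comment> \<open>The Yoneda lemma for the copresheaf \<open>neg (T z)\<close>: one direction
      takes \<open>b = a\<close> and the identity, the other uses the action of
      \<open>A\<close>.\<close>
    also have "\<dots> \<longleftrightarrow> f \<preceq> neg (ev (T z) a)"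
    proof
      assume "\<forall>b \<in> obj A. qhom A a b \<odot> f \<preceq> neg (ev (T z) b)"
      then have 1: "qhom A a a \<odot> f \<preceq> neg (ev (T z) a)" using a by blast
      have "qid Q (otyp A a) \<odot> f \<preceq> qhom A a a \<odot> f"
        using comp_mono_left[OF qcat_id[OF A a] f id_closed[OF A_typ[OF a]] hom[OF a a]] .
      from hom_trans[OF this 1 _ comp_closed[OF f hom[OF a a]] negT_hom[OF z a]]
      show "f \<preceq> neg (ev (T z) a)" using f by (simp add: id_left)
    next
      assume le: "f \<preceq> neg (ev (T z) a)"
      show "\<forall>b \<in> obj A. qhom A a b \<odot> f \<preceq> neg (ev (T z) b)"
      proof
        fix b assume b: "b \<in> obj A"
        from hom_trans[OF comp_mono_right[OF le f negT_hom[OF z a] hom[OF a b]]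
            negT_action[OF z a b] comp_closed[OF f hom[OF a b]]
            comp_closed[OF negT_hom[OF z a] hom[OF a b]] negT_hom[OF z b]]
        show "qhom A a b \<odot> f \<preceq> neg (ev (T z) b)" .
      qed
    qed
    finally show "f \<preceq> qhom A z (G a) \<longleftrightarrow> f \<preceq> neg (ev (T z) a)" .
  qed

  \<comment> \<open>By \<open>hom_G\<close>, A(G a, G -) is the copresheaf
    \<open>neg (T (G a))\<close>; its action on the identity of \<open>G a\<close> gives the
    bound.\<close>
  have G_functor: "qhom A a b \<preceq> qhom A (G a) (G b)" if a: "a \<in> obj A" and b: "b \<in> obj A" for a b
  proof -
    note Ga = G(1)[OF a]
    note ab = hom[OF a b]
    have hGa: "qhom A (G a) (G a) \<in> Homs Q (otyp A a) (otyp A a)"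
      "qhom A (G a) (G b) \<in> Homs Q (otyp A a) (otyp A b)"
      using hom[of "G a" "G a"] hom[of "G a" "G b"] G a b by auto
    have "qid Q (otyp A a) \<preceq> qhom A (G a) (G a)" using qcat_id[OF A Ga] G a by simp
    from comp_mono_right[OF this id_closed[OF A_typ[OF a]] hGa(1) ab]
    have 1: "qhom A a b \<preceq> qhom A a b \<odot> qhom A (G a) (G a)" by (simp add: id_right[OF ab])
    have 2: "qhom A a b \<odot> qhom A (G a) (G a) \<preceq> qhom A (G a) (G b)"
      using negT_action[OF Ga a b] hom_G Ga a b by simp
    from hom_trans[OF 1 2 ab comp_closed[OF hGa(1) ab] hGa(2)] show ?thesis .
  qed

  \<comment> \<open>Every \<open>x\<close> is the infimum of the objects \<open>G a\<close>, weighted by \<open>A(x, G -)\<close>.\<close>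
  have density: "f \<preceq> qhom A z x"
    if z: "z \<in> obj A" and x: "x \<in> obj A" and f: "f \<in> Homs Q (otyp A z) (otyp A x)"
      and le: "\<And>a. a \<in> obj A \<Longrightarrow> qhom A x (G a) \<odot> f \<preceq> qhom A z (G a)" for f x z
  proof -
    \<comment> \<open>The supremum of the representable at \<open>x\<close>. The counit gives
      \<open>?x\<close> \<le> \<open>x\<close>, so it suffices to bound \<open>f\<close> by A(z,
      ?x), which is the presheaf hom from \<open>T z\<close> to A(-, x).\<close>
    let ?x = "S (yC x)"
    have Sx: "?x \<in> obj A" "otyp A ?x = otyp A x" using S_obj yC_obj x by auto
    have ax: "ev (yC x) a = qhom A a x" if "a \<in> obj A" for a using yC_ev x that by blast
    have "qhom C (yC x) (yC x) = qhom A ?x x" using S_adj yC_obj x by simp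
    then have "underlying_le Q A ?x x"
      using qcat_id[OF Cat, of "yC x"] yC_obj x Sx by (simp add: underlying_le_def)
    then have 1: "qhom A z ?x \<preceq> qhom A z x" using qhom_mono[OF A z Sx(1) x] by simp
    have "f \<odot> ev (T z) a \<preceq> qhom A a x" if a: "a \<in> obj A" for a
    proof -
      \<comment> \<open>The hypothesis on \<open>G a\<close>, rewritten by \<open>hom_G\<close>, is
        exactly the negated form of this inequality.\<close>
      have "f \<odot> ev (T z) a \<preceq> ev (T x) a"
        using neg_transpose[OF f T_hom[OF z a] T_hom[OF x a]] le[OF a] hom_G x z a by simp
      \<comment> \<open>Transpose under \<open>T\<close> -| \<open>S\<close> of \<open>x\<close>
        \<le> \<open>?x\<close>; the latter is the unit of \<open>S\<close> -| \<open>yC\<close> at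
        the representable, read off at component \<open>x\<close>.\<close>
      moreover have "ev (T x) a \<preceq> qhom A a x"
      proof -
        have "qid Q (otyp A x) \<preceq> qhom A ?x ?x" using qcat_id[OF A Sx(1)] Sx by simp
        also have "qhom A ?x ?x = qhom C (yC x) (yC ?x)" using S_adj yC_obj x Sx by simp
        finally have "qid Q (otyp A x) \<odot> qhom A x x \<preceq> qhom A x ?x"
          using le_C_iff[of "yC x" "yC ?x" "qid Q (otyp A x)"] yC_obj yC_ev Sx x
            id_closed[OF A_typ[OF x]] by simp
        then have le': "qhom A x x \<preceq> qhom A x ?x" using id_left[OF hom[OF x x]] by simp
        have hx: "qhom A x ?x \<in> Homs Q (otyp A x) (otyp A x)" using hom[OF x Sx(1)] Sx by simp
        from hom_trans[OF qcat_id[OF A x] le' id_closed[OF A_typ[OF x]] hom[OF x x] hx]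
        have "qid Q (otyp A x) \<preceq> qhom C (T x) (yC x)" using T_adj yC_obj x by simp
        then have "qid Q (otyp A x) \<odot> ev (T x) a \<preceq> qhom A a x"
          using le_C_iff[of "T x" "yC x" "qid Q (otyp A x)"] T_obj yC_obj ax x a
            id_closed[OF A_typ[OF x]] by simp
        then show ?thesis using id_left[OF T_hom[OF x a]] by simp
      qed
      ultimately show ?thesis
        by (rule hom_trans[OF _ _ comp_closed[OF T_hom[OF z a] f] T_hom[OF x a] hom[OF a x]])
    qed
    then have "f \<preceq> qhom A z ?x"
      using le_C_iff[of "T z" "yC x" f] T_adj T_obj yC_obj ax x z f by simp
    from hom_trans[OF this 1 f _ hom[OF z x]] show ?thesis using hom[OF z Sx(1)] Sx by simp
  qed

  \<comment> \<open>The infimum functor: restriction along \<open>G\<close>, negation,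
    supremum\<close>
  have "\<exists>M. \<forall>v \<in> obj D. M v \<in> obj C \<and> otyp C (M v) = otyp D v \<and>
      (\<forall>a \<in> obj A. ev (M v) a = neg (cv v (G a)))"
  proof (intro bchoice ballI)
    fix v assume v: "v \<in> obj D"
    \<comment> \<open>Restricting \<open>cv v\<close> along \<open>G\<close> gives a copresheaf
      because \<open>G\<close> is functorial; negation then makes it a presheaf.\<close>
    have "neg (cv v (G b)) \<odot> qhom A a b \<preceq> neg (cv v (G a))"
      if a: "a \<in> obj A" and b: "b \<in> obj A" for a b
    proof (rule neg_action_op)
      have h: "cv v (G a) \<in> Homs Q (otyp D v) (otyp A a)" "cv v (G b) \<in> Homs Q (otyp D v) (otyp A b)"
        "qhom A (G a) (G b) \<in> Homs Q (otyp A a) (otyp A b)"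
        using cv_hom[OF v, of "G a"] cv_hom[OF v, of "G b"] hom[of "G a" "G b"] G a b by auto
      show "qhom A a b \<odot> cv v (G a) \<preceq> cv v (G b)"
        using hom_trans[OF comp_mono_left[OF G_functor[OF a b] h(1) hom[OF a b] h(3)]
            cv_action[OF v G(1)[OF b] G(1)[OF a]]
            comp_closed[OF h(1) hom[OF a b]] comp_closed[OF h(1,3)] h(2)] .
      show "qhom A a b \<in> Homs Q (otyp A a) (otyp A b)" using hom a b .
      show "cv v (G a) \<in> Homs Q (otyp D v) (otyp A a)" "cv v (G b) \<in> Homs Q (otyp D v) (otyp A b)"
        by (fact h)+
    qed
    moreover have "neg (cv v (G a)) \<in> Homs Q (otyp A a) (otyp D v)" if "a \<in> obj A" for a
      using cv_hom[OF v, of "G a"] G that by (auto intro: neg_closed)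
    ultimately have "\<exists>u \<in> obj C. otyp C u = otyp D v \<and> (\<forall>a \<in> obj A. ev u a = neg (cv v (G a)))"
      using D_typ[OF v] by (intro presents_presheaves_obtain[OF C]) auto
    then show "\<exists>u. u \<in> obj C \<and> otyp C u = otyp D v \<and> (\<forall>a \<in> obj A. ev u a = neg (cv v (G a)))"
      by blast
  qed
  then obtain M where M: "M v \<in> obj C" "otyp C (M v) = otyp D v"
    and M_ev: "a \<in> obj A \<Longrightarrow> ev (M v) a = neg (cv v (G a))" if "v \<in> obj D" for v a
    by blast
  define I where "I v = S (M v)" for v
  have I: "I v \<in> obj A" "otyp A (I v) = otyp D v" if "v \<in> obj D" for v
    using S_obj M that by (auto simp: I_def)
  have cvG: "cv v (G a) \<in> Homs Q (otyp D v) (otyp A a)" if "v \<in> obj D" "a \<in> obj A" for v a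
    using cv_hom[of v "G a"] G that by simp

  have I_hom: "qhom A z (I v) = qhom D v (yD z)" if v: "v \<in> obj D" and z: "z \<in> obj A" for v z
  proof (rule hom_eqI[of _ "otyp A z" "otyp D v"])
    show "qhom A z (I v) \<in> Homs Q (otyp A z) (otyp D v)" using hom[of z "I v"] I v z by simp
    show "qhom D v (yD z) \<in> Homs Q (otyp A z) (otyp D v)" using D_hom[of v "yD z"] yD_obj v z by simp
    fix f assume f: "f \<in> Homs Q (otyp A z) (otyp D v)"
    have "f \<preceq> qhom A z (I v) \<longleftrightarrow> f \<preceq> qhom C (T z) (M v)"
      using T_adj M v z by (simp add: I_def)
    also have "\<dots> \<longleftrightarrow> (\<forall>a \<in> obj A. f \<odot> ev (T z) a \<preceq> neg (cv v (G a)))"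
      using le_C_iff[of "T z" "M v" f] T_obj M M_ev z v f by simp
    also have "\<dots> \<longleftrightarrow> (\<forall>a \<in> obj A. cv v (G a) \<odot> f \<preceq> qhom A z (G a))"
    proof (intro ball_cong refl)
      fix a assume a: "a \<in> obj A"
      show "f \<odot> ev (T z) a \<preceq> neg (cv v (G a)) \<longleftrightarrow> cv v (G a) \<odot> f \<preceq> qhom A z (G a)"
        using neg_transpose[OF f T_hom[OF z a] neg_closed[OF cvG[OF v a]]] neg_neg[OF cvG[OF v a]]
          hom_G[OF z a] by simp
    qed
    \<comment> \<open>The passage from the objects \<open>G a\<close> to all \<open>x\<close> is
      \<open>density\<close> for the composite of \<open>f\<close> with \<open>cv v x\<close>; its
      tests follow from the action of A(x, G a) on \<open>cv v\<close>.\<close>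
    also have "\<dots> \<longleftrightarrow> (\<forall>x \<in> obj A. cv v x \<odot> f \<preceq> qhom A z x)"
    proof
      assume le: "\<forall>a \<in> obj A. cv v (G a) \<odot> f \<preceq> qhom A z (G a)"
      show "\<forall>x \<in> obj A. cv v x \<odot> f \<preceq> qhom A z x"
      proof
        fix x assume x: "x \<in> obj A"
        note vx = cv_hom[OF v x]
        show "cv v x \<odot> f \<preceq> qhom A z x"
        proof (rule density[OF z x comp_closed[OF f vx]])
          fix a assume a: "a \<in> obj A"
          note xG = G_hom(1)[OF x a]
          have "(qhom A x (G a) \<odot> cv v x) \<odot> f \<preceq> cv v (G a) \<odot> f"
            by (rule comp_mono_left[OF cv_action[OF v G(1)[OF a] x] f comp_closed[OF vx xG] cvG[OF v a]])
          from hom_trans[OF this _ comp_closed[OF f comp_closed[OF vx xG]]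
              comp_closed[OF f cvG[OF v a]] G_hom(1)[OF z a]]
          show "qhom A x (G a) \<odot> (cv v x \<odot> f) \<preceq> qhom A z (G a)"
            using le a comp_assoc[OF f vx xG] by simp
        qed
      qed
    qed (use G in blast)
    also have "\<dots> \<longleftrightarrow> f \<preceq> qhom D v (yD z)"
      using le_D_iff[of v "yD z" f] yD_obj yD_cv v z f by simp
    finally show "f \<preceq> qhom A z (I v) \<longleftrightarrow> f \<preceq> qhom D v (yD z)" .
  qed

  \<comment> \<open>The right adjoint of the infimum\<close>
  let ?F = "\<lambda>z b. (\<lambda>a. qhom A (G a) b \<odot> neg (qhom A a z)) ` obj A"
  \<comment> \<open>The left Kan extension along \<open>G\<close> of the copresheaf
    \<open>neg (qhom A - z)\<close>. Homs of copresheaves reverse the pointwise order, so extension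
    is right adjoint to restriction there.\<close>
  let ?r = "\<lambda>z b. \<Squnion>\<^bsub>hom_order Q (otyp A z) (otyp A b)\<^esub> (?F z b)"
  have F_sub: "?F z b \<subseteq> Homs Q (otyp A z) (otyp A b)" if "z \<in> obj A" "b \<in> obj A" for z b
    using that G_hom hom by (auto intro!: comp_closed[OF neg_closed])
  have r_hom: "?r z b \<in> Homs Q (otyp A z) (otyp A b)" if "z \<in> obj A" "b \<in> obj A" for z b
    using Sup_closed[OF A_typ A_typ F_sub] that by blast
  have "\<exists>R. \<forall>z \<in> obj A. R z \<in> obj D \<and> otyp D (R z) = otyp A z \<and>
      (\<forall>b \<in> obj A. cv (R z) b = ?r z b)"
  proof (intro bchoice ballI)
    fix z assume z: "z \<in> obj A"
    have "qhom A b c \<odot> ?r z b \<preceq> ?r z c" if b: "b \<in> obj A" and c: "c \<in> obj A" for b c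
      unfolding comp_Sup_le_iff[OF F_sub[OF z b] hom[OF b c] r_hom[OF z c]]
    proof (intro ballI, elim imageE, simp only:)
      fix a assume a: "a \<in> obj A"
      note az = neg_closed[OF hom[OF a z]] and Gb = G_hom(2)[OF b a] and Gc = G_hom(2)[OF c a]
      have "(qhom A b c \<odot> qhom A (G a) b) \<odot> neg (qhom A a z) \<preceq> qhom A (G a) c \<odot> neg (qhom A a z)"
        by (rule comp_mono_left[OF qcat_comp[OF A G(1)[OF a] b c] az comp_closed[OF Gb hom[OF b c]] Gc])
      moreover have "qhom A (G a) c \<odot> neg (qhom A a z) \<preceq> ?r z c"
        using a by (intro le_Sup F_sub z c) auto
      ultimately have "(qhom A b c \<odot> qhom A (G a) b) \<odot> neg (qhom A a z) \<preceq> ?r z c"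
        by (rule hom_trans[OF _ _ comp_closed[OF az comp_closed[OF Gb hom[OF b c]]]
              comp_closed[OF az Gc] r_hom[OF z c]])
      then show "qhom A b c \<odot> (qhom A (G a) b \<odot> neg (qhom A a z)) \<preceq> ?r z c"
        using comp_assoc[OF az Gb hom[OF b c]] by simp
    qed
    then have "\<exists>v \<in> obj D. otyp D v = otyp A z \<and> (\<forall>b \<in> obj (op_qcat A). cv v b = ?r z b)"
      using z A_typ r_hom by (intro presents_presheaves_obtain[OF D]) auto
    then show "\<exists>v. v \<in> obj D \<and> otyp D v = otyp A z \<and> (\<forall>b \<in> obj A. cv v b = ?r z b)" by auto
  qed
  then obtain R where R: "R z \<in> obj D" "otyp D (R z) = otyp A z"
    and R_cv: "b \<in> obj A \<Longrightarrow> cv (R z) b = ?r z b" if "z \<in> obj A" for z b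
    by blast

  have R_hom: "qhom A (I v) z = qhom D (R z) v" if v: "v \<in> obj D" and z: "z \<in> obj A" for v z
  proof (rule hom_eqI[of _ "otyp D v" "otyp A z"])
    show "qhom A (I v) z \<in> Homs Q (otyp D v) (otyp A z)" using hom[of "I v" z] I v z by simp
    show "qhom D (R z) v \<in> Homs Q (otyp D v) (otyp A z)" using D_hom[of "R z" v] R v z by simp
    fix f assume f: "f \<in> Homs Q (otyp D v) (otyp A z)"
    have "f \<preceq> qhom A (I v) z \<longleftrightarrow> f \<preceq> qhom C (M v) (yC z)"
      using S_adj M v z by (simp add: I_def)
    also have "\<dots> \<longleftrightarrow> (\<forall>a \<in> obj A. f \<odot> neg (cv v (G a)) \<preceq> qhom A a z)"
      using le_C_iff[of "M v" "yC z" f] yC_obj yC_ev M M_ev z v f by simp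
    also have "\<dots> \<longleftrightarrow> (\<forall>a \<in> obj A. neg (qhom A a z) \<odot> f \<preceq> cv v (G a))"
    proof (intro ball_cong refl)
      fix a assume a: "a \<in> obj A"
      show "f \<odot> neg (cv v (G a)) \<preceq> qhom A a z \<longleftrightarrow> neg (qhom A a z) \<odot> f \<preceq> cv v (G a)"
        using neg_transpose[OF f neg_closed[OF cvG[OF v a]] hom[OF a z]] neg_neg[OF cvG[OF v a]]
        by simp
    qed
    \<comment> \<open>The universal property of the Kan extension: act by A(G a, b) on the bound at
      \<open>G a\<close>, and conversely take \<open>b = G a\<close> and use its identity.\<close>
    also have "\<dots> \<longleftrightarrow> (\<forall>b \<in> obj A. \<forall>a \<in> obj A. (qhom A (G a) b \<odot> neg (qhom A a z)) \<odot> f \<preceq> cv v b)"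
    proof (intro iffI ballI)
      fix a b assume a: "a \<in> obj A" and b: "b \<in> obj A"
      assume "\<forall>a \<in> obj A. neg (qhom A a z) \<odot> f \<preceq> cv v (G a)"
      then have le: "neg (qhom A a z) \<odot> f \<preceq> cv v (G a)" using a by blast
      note az = neg_closed[OF hom[OF a z]] and Gb = G_hom(2)[OF b a]
      from hom_trans[OF comp_mono_right[OF le comp_closed[OF f az] cvG[OF v a] Gb]
          cv_action[OF v b G(1)[OF a]] comp_closed[OF comp_closed[OF f az] Gb]
          comp_closed[OF cvG[OF v a] Gb] cv_hom[OF v b]]
      show "(qhom A (G a) b \<odot> neg (qhom A a z)) \<odot> f \<preceq> cv v b"
        using comp_assoc[OF f az Gb] by simp
    next
      fix a assume a: "a \<in> obj A"
      assume "\<forall>b \<in> obj A. \<forall>a \<in> obj A. (qhom A (G a) b \<odot> neg (qhom A a z)) \<odot> f \<preceq> cv v b"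
      then have le: "(qhom A (G a) (G a) \<odot> neg (qhom A a z)) \<odot> f \<preceq> cv v (G a)"
        using a G by blast
      note az = neg_closed[OF hom[OF a z]]
      have GG: "qhom A (G a) (G a) \<in> Homs Q (otyp A a) (otyp A a)"
        using G_hom(2)[OF G(1) a] G a by simp
      have "qid Q (otyp A a) \<preceq> qhom A (G a) (G a)" using qcat_id[OF A G(1)[OF a]] G a by simp
      from comp_mono_left[OF this comp_closed[OF f az] id_closed[OF A_typ[OF a]] GG]
      have "neg (qhom A a z) \<odot> f \<preceq> (qhom A (G a) (G a) \<odot> neg (qhom A a z)) \<odot> f"
        using id_left[OF comp_closed[OF f az]] comp_assoc[OF f az GG] by simp
      from hom_trans[OF this le comp_closed[OF f az] comp_closed[OF f comp_closed[OF az GG]]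
          cvG[OF v a]]
      show "neg (qhom A a z) \<odot> f \<preceq> cv v (G a)" .
    qed
    also have "\<dots> \<longleftrightarrow> (\<forall>b \<in> obj A. ?r z b \<odot> f \<preceq> cv v b)"
    proof (intro ball_cong refl)
      fix b assume b: "b \<in> obj A"
      show "(\<forall>a \<in> obj A. (qhom A (G a) b \<odot> neg (qhom A a z)) \<odot> f \<preceq> cv v b) \<longleftrightarrow>
          ?r z b \<odot> f \<preceq> cv v b"
        using Sup_comp_le_iff[OF F_sub[OF z b] f cv_hom[OF v b]] by simp
    qed
    also have "\<dots> \<longleftrightarrow> f \<preceq> qhom D (R z) v"
      using le_D_iff[of "R z" v f] R R_cv v z f by simp
    finally show "f \<preceq> qhom A (I v) z \<longleftrightarrow> f \<preceq> qhom D (R z) v" .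
  qed

  have "qadjoint (op_quantaloid Q) D (op_qcat A) I yD"
    unfolding op.qadjoint_iff_hom[OF Dat Aop] using I I_hom yD_obj by simp
  moreover have "qadjoint (op_quantaloid Q) (op_qcat A) D R I"
    unfolding op.qadjoint_iff_hom[OF Aop Dat] using I R R_hom by simp
  ultimately show ?thesis by blast
qed


section \<open>The presheaf and copresheaf categories\<close>

context quantaloid
begin

lemma distributor_into_star:
  assumes "X \<in> objs Q" "qcategory Q A"
  shows "distributor Q A (star Q X) \<mu> \<longleftrightarrow>
    \<mu> \<in> extensional (obj A \<times> {()}) \<and> presheaf Q A X (\<lambda>a. \<mu> (a, ()))"
proof -
  have "\<mu> \<in> (\<Pi>\<^sub>E (x, y) \<in> obj A \<times> {()}. Homs Q (otyp A x) X) \<longleftrightarrow>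
      \<mu> \<in> extensional (obj A \<times> {()}) \<and> (\<forall>a \<in> obj A. \<mu> (a, ()) \<in> Homs Q (otyp A a) X)"
    by (auto simp: PiE_def Pi_def)
  moreover have "qid Q X \<odot> \<mu> (a, ()) = \<mu> (a, ())" if "\<mu> (a, ()) \<in> Homs Q (otyp A a) X" for a
    using id_left[OF that] .
  ultimately show ?thesis
    by (auto simp: distributor_def presheaf_def star_def)
qed

lemma distributor_from_star:
  assumes "X \<in> objs Q" "qcategory Q A"
  shows "distributor Q (star Q X) A \<mu> \<longleftrightarrow>
    \<mu> \<in> extensional ({()} \<times> obj A) \<and>
    presheaf (op_quantaloid Q) (op_qcat A) X (\<lambda>a. \<mu> ((), a))"
proof -
  have "\<mu> \<in> (\<Pi>\<^sub>E (x, y) \<in> {()} \<times> obj A. Homs Q X (otyp A y)) \<longleftrightarrow>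
      \<mu> \<in> extensional ({()} \<times> obj A) \<and> (\<forall>a \<in> obj A. \<mu> ((), a) \<in> Homs Q X (otyp A a))"
    by (auto simp: PiE_def Pi_def)
  moreover have "(qhom A y y' \<odot> \<mu> ((), y)) \<odot> qid Q X = qhom A y y' \<odot> \<mu> ((), y)"
    if "\<mu> ((), y) \<in> Homs Q X (otyp A y)" "y \<in> obj A" "y' \<in> obj A" for y y'
    using id_right[OF comp_closed[OF that(1) qcat_hom[OF assms(2) that(2,3)]]] .
  ultimately show ?thesis
    by (auto simp: distributor_def presheaf_def star_def)
qed

text \<open>Both actions are by identities, so the action inequality is reflexivity, and
  extensionality on a one-point domain is vacuous.\<close>

lemma distributor_star_star:
  assumes "X \<in> objs Q" "Y \<in> objs Q"
  shows "distributor Q (star Q X) (star Q Y) \<psi> \<longleftrightarrow> \<psi> ((), ()) \<in> Homs Q X Y"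
  using assms
  by (auto simp: distributor_def star_def id_left id_right hom_refl PiE_def Pi_def extensional_def)

text \<open>Composition over the single object of \<open>star Q X\<close> is a join of one arrow, so
  the distributor residual reduces to the largest arrow satisfying a family of inequalities in
  \<open>Q\<close>.\<close>

lemma dist_lres_presheaves:
  assumes X: "X \<in> objs Q" and Y: "Y \<in> objs Q"
    and \<mu>: "\<And>a. a \<in> obj A \<Longrightarrow> \<mu> (a, ()) \<in> Homs Q (otyp A a) X"
    and \<nu>: "\<And>a. a \<in> obj A \<Longrightarrow> \<nu> (a, ()) \<in> Homs Q (otyp A a) Y"
  shows "dist_lres Q A (star Q X) (star Q Y) \<nu> \<mu> ((), ()) \<in> Homs Q X Y"
    and "f \<in> Homs Q X Y \<Longrightarrow> f \<preceq> dist_lres Q A (star Q X) (star Q Y) \<nu> \<mu> ((), ()) \<longleftrightarrow>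
      (\<forall>a \<in> obj A. f \<odot> \<mu> (a, ()) \<preceq> \<nu> (a, ()))"
proof -
  obtain r where r: "r \<in> Homs Q X Y"
    and le_r: "\<And>g. g \<in> Homs Q X Y \<Longrightarrow> g \<preceq> r \<longleftrightarrow> (\<forall>a \<in> obj A. g \<odot> \<mu> (a, ()) \<preceq> \<nu> (a, ()))"
    using residual_exists[OF X Y, of "obj A" "\<lambda>a. \<mu> (a, ())" "otyp A" "\<lambda>a. \<nu> (a, ())"] \<mu> \<nu> by auto
  have comp: "dist_le Q A (star Q Y) (dist_comp Q A (star Q X) (star Q Y) \<psi> \<mu>) \<nu> \<longleftrightarrow>
      \<psi> ((), ()) \<preceq> r" if "\<psi> ((), ()) \<in> Homs Q X Y" for \<psi>
    using that le_r Sup_singleton[OF comp_closed[OF \<mu> that]]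
    by (simp add: dist_le_def dist_comp_def star_def)
  have "dist_lres Q A (star Q X) (star Q Y) \<nu> \<mu> = (\<lambda>_. r)"
    unfolding dist_lres_def distributor_star_star[OF X Y]
  proof (rule the_equality)
    fix \<rho> assume \<rho>: "\<rho> ((), ()) \<in> Homs Q X Y \<and> (\<forall>\<psi>. \<psi> ((), ()) \<in> Homs Q X Y \<longrightarrow>
      (dist_le Q A (star Q Y) (dist_comp Q A (star Q X) (star Q Y) \<psi> \<mu>) \<nu> \<longleftrightarrow>
        dist_le Q (star Q X) (star Q Y) \<psi> \<rho>))"
    have "\<rho> ((), ()) = r"
    proof (rule hom_eqI[OF _ r])
      fix g assume g: "g \<in> Homs Q X Y"
      then show "g \<preceq> \<rho> ((), ()) \<longleftrightarrow> g \<preceq> r"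
        using \<rho>[THEN conjunct2, rule_format, of "\<lambda>_. g"] comp[of "\<lambda>_. g"]
        by (simp add: dist_le_def star_def)
    qed (use \<rho> in blast)
    then show "\<rho> = (\<lambda>_. r)" by (simp add: fun_eq_iff)
  qed (use r comp in \<open>simp add: dist_le_def star_def\<close>)
  then show "dist_lres Q A (star Q X) (star Q Y) \<nu> \<mu> ((), ()) \<in> Homs Q X Y"
    and "f \<in> Homs Q X Y \<Longrightarrow> f \<preceq> dist_lres Q A (star Q X) (star Q Y) \<nu> \<mu> ((), ()) \<longleftrightarrow>
      (\<forall>a \<in> obj A. f \<odot> \<mu> (a, ()) \<preceq> \<nu> (a, ()))"
    using r le_r by simp_all
qed

lemma dist_rres_copresheaves:
  assumes X: "X \<in> objs Q" and Y: "Y \<in> objs Q"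
    and \<mu>: "\<And>a. a \<in> obj A \<Longrightarrow> \<mu> ((), a) \<in> Homs Q X (otyp A a)"
    and \<nu>: "\<And>a. a \<in> obj A \<Longrightarrow> \<nu> ((), a) \<in> Homs Q Y (otyp A a)"
  shows "dist_rres Q (star Q Y) (star Q X) A \<mu> \<nu> ((), ()) \<in> Homs Q Y X"
    and "f \<in> Homs Q Y X \<Longrightarrow> f \<preceq> dist_rres Q (star Q Y) (star Q X) A \<mu> \<nu> ((), ()) \<longleftrightarrow>
      (\<forall>a \<in> obj A. \<mu> ((), a) \<odot> f \<preceq> \<nu> ((), a))"
proof -
  interpret op: quantaloid "op_quantaloid Q" by (rule quantaloid_op) unfold_locales
  \<comment> \<open>Taken in the opposite quantaloid, the residual of the family is the largest
    arrow to precompose with.\<close>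
  obtain r where r: "r \<in> Homs Q Y X"
    and le_r: "\<And>g. g \<in> Homs Q Y X \<Longrightarrow> g \<preceq> r \<longleftrightarrow> (\<forall>a \<in> obj A. \<mu> ((), a) \<odot> g \<preceq> \<nu> ((), a))"
    using op.residual_exists[of X Y "obj A" "\<lambda>a. \<mu> ((), a)" "otyp A" "\<lambda>a. \<nu> ((), a)"] X Y \<mu> \<nu>
    by auto
  have comp: "dist_le Q (star Q Y) A (dist_comp Q (star Q Y) (star Q X) A \<mu> \<phi>) \<nu> \<longleftrightarrow>
      \<phi> ((), ()) \<preceq> r" if "\<phi> ((), ()) \<in> Homs Q Y X" for \<phi>
    using that le_r Sup_singleton[OF comp_closed[OF that \<mu>]]
    by (simp add: dist_le_def dist_comp_def star_def)
  have "dist_rres Q (star Q Y) (star Q X) A \<mu> \<nu> = (\<lambda>_. r)"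
    unfolding dist_rres_def distributor_star_star[OF Y X]
  proof (rule the_equality)
    fix \<rho> assume \<rho>: "\<rho> ((), ()) \<in> Homs Q Y X \<and> (\<forall>\<phi>. \<phi> ((), ()) \<in> Homs Q Y X \<longrightarrow>
      (dist_le Q (star Q Y) A (dist_comp Q (star Q Y) (star Q X) A \<mu> \<phi>) \<nu> \<longleftrightarrow>
        dist_le Q (star Q Y) (star Q X) \<phi> \<rho>))"
    have "\<rho> ((), ()) = r"
    proof (rule hom_eqI[OF _ r])
      fix g assume g: "g \<in> Homs Q Y X"
      then show "g \<preceq> \<rho> ((), ()) \<longleftrightarrow> g \<preceq> r"
        using \<rho>[THEN conjunct2, rule_format, of "\<lambda>_. g"] comp[of "\<lambda>_. g"]
        by (simp add: dist_le_def star_def)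
    qed (use \<rho> in blast)
    then show "\<rho> = (\<lambda>_. r)" by (simp add: fun_eq_iff)
  qed (use r comp in \<open>simp add: dist_le_def star_def\<close>)
  then show "dist_rres Q (star Q Y) (star Q X) A \<mu> \<nu> ((), ()) \<in> Homs Q Y X"
    and "f \<in> Homs Q Y X \<Longrightarrow> f \<preceq> dist_rres Q (star Q Y) (star Q X) A \<mu> \<nu> ((), ()) \<longleftrightarrow>
      (\<forall>a \<in> obj A. \<mu> ((), a) \<odot> f \<preceq> \<nu> ((), a))"
    using r le_r by simp_all
qed

lemma presents_presheaves_presheaves:
  assumes A: "qcategory Q A"
  shows "presents_presheaves Q A (presheaves Q A) (\<lambda>u a. snd u (a, ()))"
  unfolding presents_presheaves_def
proof (intro conjI ballI allI impI)
  fix u assume u: "u \<in> obj (presheaves Q A)"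
  then have u': "fst u \<in> objs Q" "presheaf Q A (fst u) (\<lambda>a. snd u (a, ()))"
    using A by (auto simp: presheaves_def distributor_into_star)
  then show "otyp (presheaves Q A) u \<in> objs Q"
    "presheaf Q A (otyp (presheaves Q A) u) (\<lambda>a. snd u (a, ()))"
    by (simp_all add: presheaves_def)
  fix v assume v: "v \<in> obj (presheaves Q A)"
  then have v': "fst v \<in> objs Q" "presheaf Q A (fst v) (\<lambda>a. snd v (a, ()))"
    using A by (auto simp: presheaves_def distributor_into_star)
  note res = dist_lres_presheaves[OF u'(1) v'(1), of A "snd u" "snd v"]
  show "qhom (presheaves Q A) u v \<in>
      Homs Q (otyp (presheaves Q A) u) (otyp (presheaves Q A) v)"
    using res(1) u'(2) v'(2) by (simp add: presheaves_def split_beta presheaf_def)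
  fix f assume "f \<in> Homs Q (otyp (presheaves Q A) u) (otyp (presheaves Q A) v)"
  then show "f \<preceq> qhom (presheaves Q A) u v \<longleftrightarrow>
      (\<forall>a \<in> obj A. f \<odot> snd u (a, ()) \<preceq> snd v (a, ()))"
    using res(2) u'(2) v'(2) by (simp add: presheaves_def split_beta presheaf_def)
next
  fix X m assume "X \<in> objs Q" "presheaf Q A X m"
  then show "\<exists>u \<in> obj (presheaves Q A). otyp (presheaves Q A) u = X \<and>
      (\<forall>a \<in> obj A. snd u (a, ()) = m a)"
    by (intro bexI[of _ "(X, \<lambda>(a, _) \<in> obj A \<times> {()}. m a)"])
      (auto simp: presheaves_def distributor_into_star A presheaf_def)
qed

text \<open>The residual defining the homs of \<open>copresheaves\<close> takes its arguments in
  reversed order. The opposite category undoes this, and composition in the opposite quantaloid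
  turns precomposition into postcomposition.\<close>

lemma presents_presheaves_copresheaves:
  assumes A: "qcategory Q A"
  shows "presents_presheaves (op_quantaloid Q) (op_qcat A) (op_qcat (copresheaves Q A))
    (\<lambda>u a. snd u ((), a))"
  unfolding presents_presheaves_def
proof (intro conjI ballI allI impI)
  let ?D = "op_qcat (copresheaves Q A)" and ?p = "presheaf (op_quantaloid Q) (op_qcat A)"
  fix u assume u: "u \<in> obj ?D"
  then have u': "fst u \<in> objs Q" "?p (fst u) (\<lambda>a. snd u ((), a))"
    using A by (auto simp: copresheaves_def distributor_from_star)
  then show "otyp ?D u \<in> objs (op_quantaloid Q)" "?p (otyp ?D u) (\<lambda>a. snd u ((), a))"
    by (simp_all add: copresheaves_def)
  fix v assume v: "v \<in> obj ?D"
  then have v': "fst v \<in> objs Q" "?p (fst v) (\<lambda>a. snd v ((), a))"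
    using A by (auto simp: copresheaves_def distributor_from_star)
  note res = dist_rres_copresheaves[OF u'(1) v'(1), of A "snd u" "snd v"]
  show "qhom ?D u v \<in> Homs (op_quantaloid Q) (otyp ?D u) (otyp ?D v)"
    using res(1) u'(2) v'(2) by (simp add: copresheaves_def split_beta presheaf_def)
  fix f assume "f \<in> Homs (op_quantaloid Q) (otyp ?D u) (otyp ?D v)"
  then show "f \<preceq>\<^bsub>op_quantaloid Q\<^esub> qhom ?D u v \<longleftrightarrow> (\<forall>a \<in> obj (op_qcat A).
      f \<odot>\<^bsub>op_quantaloid Q\<^esub> snd u ((), a) \<preceq>\<^bsub>op_quantaloid Q\<^esub> snd v ((), a))"
    using res(2) u'(2) v'(2) by (simp add: copresheaves_def split_beta presheaf_def)
next
  fix X m assume "X \<in> objs (op_quantaloid Q)" "presheaf (op_quantaloid Q) (op_qcat A) X m"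
  then show "\<exists>u \<in> obj (op_qcat (copresheaves Q A)). otyp (op_qcat (copresheaves Q A)) u = X \<and>
      (\<forall>a \<in> obj (op_qcat A). snd u ((), a) = m a)"
    by (intro bexI[of _ "(X, \<lambda>(_, a) \<in> {()} \<times> obj A. m a)"])
      (auto simp: copresheaves_def distributor_from_star A presheaf_def)
qed

lemma is_yoneda_yoneda:
  assumes "qcategory Q A"
  shows "is_yoneda A (presheaves Q A) (\<lambda>u a. snd u (a, ())) (yoneda A)"
  using assms
  by (auto simp: is_yoneda_def yoneda_def presheaves_def distributor_into_star presheaf_def
      qcat_typ qcat_hom intro: qcat_comp)

lemma is_yoneda_coyoneda:
  assumes "qcategory Q A"
  shows "is_yoneda (op_qcat A) (op_qcat (copresheaves Q A)) (\<lambda>u a. snd u ((), a)) (coyoneda A)"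
  using assms
  by (auto simp: is_yoneda_def coyoneda_def copresheaves_def distributor_from_star presheaf_def
      qcat_typ qcat_hom intro: qcat_comp)

end

theorem proposition7p4:
  fixes Q :: "('o, 'a) quantaloid_data"
    and d :: "'o \<Rightarrow> 'a"
    and A :: "('o, 'a, 'x) qcat_data"
  assumes "girard_quantaloid Q d"
    and "qcategory Q A"
  shows "ccd Q A \<longleftrightarrow> op_ccd Q A"
proof -
  interpret girard_quantaloid Q d by fact
  interpret op: girard_quantaloid "op_quantaloid Q" d
    by (rule girard_quantaloid_op) fact
  note A = assms(2)
  note P = presents_presheaves_presheaves[OF A] is_yoneda_yoneda[OF A]
    and P' = presents_presheaves_copresheaves[OF A] is_yoneda_coyoneda[OF A]
  have "(\<exists>S T. qadjoint Q (presheaves Q A) A S (yoneda A) \<and> qadjoint Q A (presheaves Q A) T S) \<longleftrightarrow>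
    (\<exists>I R. qadjoint (op_quantaloid Q) (op_qcat (copresheaves Q A)) (op_qcat A) I (coyoneda A) \<and>
      qadjoint (op_quantaloid Q) (op_qcat A) (op_qcat (copresheaves Q A)) R I)"
    using sup_left_adjoint_imp_inf_right_adjoint[OF A P P']
      \<comment> \<open>The converse: the roles of \<open>presheaves\<close> and
        \<open>copresheaves\<close> are exchanged, and double opposites collapse by
        rewriting.\<close>
      op.sup_left_adjoint_imp_inf_right_adjoint[OF qcategory_op[OF quantaloid_axioms A] P',
        unfolded op_quantaloid_simps op_qcat_simps, OF P]
    by blast
  \<comment> \<open>\<open>qcomplete\<close> is a conjunct on both sides, so the equivalence of the
    two pairs of adjunctions settles the claim.\<close>
  then show ?thesis
    by (simp add: qadjoint_op ccd_def op_ccd_def is_sup_def is_inf_def)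
qed

end
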